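(* Let $d\ge 2$ and $N\ge 2$ be integers and let $0<\delta<1$. There is a constant $C_{d,N,\delta}$ depending only on $d$, $N$ and $\delta$ such that the following holds. Let $I=[a,b]$ be an interval and let $f$ be a smooth real-valued function on $I$ such that $f^{(N)}$ is single-signed on $I$. Suppose that for some $A\ge 1$ and for all non-zero real $\lambda$, $$\left|\int_I e^{i\lambda f(x)}\,dx\right|\le A|\lambda|^{-\delta}.$$ Then: (i) for every polynomial $P\in\mathbb{R}[x]$ of degree $d$ such that $P'$ is monic, and for all non-zero real $\lambda$, $$\left|\int_I e^{i\lambda P(f(x))}\,dx\right|\le C_{d,N,\delta}A^{1/(1-\delta)}|\lambda|^{-\delta/d};$$ (ii) for every polynomial $P\in\mathbb{R}[x]$ of degree $d$ such that $P'$ is an SND polynomial, the same estimate holds for all real $\lambda$ with $|\lambda|\ge 1$. In particular, $C_{d,N,\delta}$ does not depend on $f$ or $I$.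
   Context: A function $g$ is single-signed on a set if either $g\ge 0$ everywhere on the set or $g\le 0$ everywhere on the set. A polynomial $Q\in\mathbb{R}[x]$ of degree $m$, $Q(x)=a_mx^m+a_{m-1}x^{m-1}+\ldots+a_1x+a_0$, is called semi-non-degenerating (SND) if $\max_{0\le j\le m}|a_{m-j}|=1$ and this maximum is attained by some $j$ with $j\le m/2$. (Here this is applied to $Q=P'$, so $m=d-1$.) *)

theory Defs
  imports
    "HOL-Analysis.Analysis"
    "HOL-Computational_Algebra.Polynomial"
begin

(* Derivatives are taken within S, so at an end point of S = {a..b} they are one-sided and
   only the values of f on S matter. For a < b they are uniquely determined. *)
primrec higher_deriv_on :: "real set \<Rightarrow> nat \<Rightarrow> (real \<Rightarrow> real) \<Rightarrow> real \<Rightarrow> real" where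
  "higher_deriv_on S 0 f = f"
| "higher_deriv_on S (Suc n) f =
     (\<lambda>x. vector_derivative (higher_deriv_on S n f) (at x within S))"

definition smooth_on :: "real set \<Rightarrow> (real \<Rightarrow> real) \<Rightarrow> bool" where
  "smooth_on S f \<longleftrightarrow> (\<forall>n. higher_deriv_on S n f differentiable_on S)"

lemma smooth_on_has_real_derivative:
  assumes "smooth_on S f" "x \<in> S"
  shows "(higher_deriv_on S n f has_real_derivative higher_deriv_on S (Suc n) f x) (at x within S)"
  using assms
  by (simp add: smooth_on_def differentiable_on_def
      has_real_derivative_iff_has_vector_derivative vector_derivative_works[symmetric])

definition single_signed_on :: "real set \<Rightarrow> (real \<Rightarrow> real) \<Rightarrow> bool" where
  "single_signed_on S g \<longleftrightarrow> (\<forall>x\<in>S. g x \<ge> 0) \<or> (\<forall>x\<in>S. g x \<le> 0)"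

definition semi_non_degenerating :: "real poly \<Rightarrow> bool" where
  "semi_non_degenerating Q \<longleftrightarrow>
     (let m = degree Q in
        (MAX j\<in>{0..m}. \<bar>coeff Q (m - j)\<bar>) = 1 \<and>
        (\<exists>j\<in>{0..m}. real j \<le> real m / 2 \<and> \<bar>coeff Q (m - j)\<bar> = 1))"

end

theory Submission
  imports Defs
begin

text \<open>
  Let \<open>r = \<bar>\<mu>\<bar> powr (-1 / d)\<close>. Integrating the decay hypothesis against a Fejer kernel shows that an
  interval on which \<open>f\<close> stays within \<open>\<rho>\<close> of a constant has length at most \<open>O(A \<rho>\<^sup>\<delta>)\<close>. Since
  \<open>f\<^sup>(\<^sup>N\<^sup>)\<close> is single-signed, \<open>{a..b}\<close> splits into boundedly many intervals on which \<open>f'\<close> and \<open>f''\<close>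
  are single-signed and each of \<open>\<bar>f'\<bar>\<close> and \<open>\<bar>P'(f)\<bar>\<close> is either everywhere at least or everywhere at
  most a threshold, \<open>\<kappa> = r powr (1 - \<delta>)\<close> and \<open>c r\<^sup>d\<^sup>-\<^sup>1\<close> respectively.
  Where \<open>\<bar>f'\<bar> \<le> \<kappa>\<close> on an interval of length \<open>L\<close>, \<open>f\<close> varies by at most \<open>\<kappa> L\<close>, so that
  \<open>L \<le> O(A (\<kappa> L)\<^sup>\<delta>)\<close>, which can be solved for \<open>L\<close>. Where \<open>\<bar>P'(f)\<bar> \<le> c r\<^sup>d\<^sup>-\<^sup>1\<close>, \<open>f\<close> varies by
  at most \<open>r\<close>, because \<open>\<bar>P'\<bar>\<close> exceeds \<open>c r\<^sup>d\<^sup>-\<^sup>1\<close> somewhere on every interval of length \<open>r\<close>. Where both are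
  large, integrate by parts.

  For the lower bound on \<open>P'\<close>: a polynomial of size at most \<open>e\<close> on an interval of length \<open>r\<close> has
  \<open>i\<close>-th Taylor coefficient \<open>O(e r\<^sup>-\<^sup>i)\<close> at the left end point, which settles the monic case. In the
  SND case and for a left end point \<open>y\<close> far from the origin, rescaling by \<open>y\<close> bounds the
  \<open>k\<close>-th coefficient, \<open>k \<ge> (d - 1) / 2\<close>, by the lower ones and by the first \<open>d - k\<close> Taylor
  coefficients at \<open>y\<close>.
\<close>

subsection \<open>Sublevel intervals\<close>

text \<open>The integral is the Fourier transform of the triangle function on [-1, 1]. For nonzero
  \<open>y\<close> the antiderivative \<open>F\<close> evaluates it to
  \<open>2 * (1 - cos y) / y^2\<close>.\<close>

lemma fejer_kernel_nonneg:
  fixes y :: real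
  shows "0 \<le> integral {0..1} (\<lambda>\<xi>. 2 * (1 - \<xi>) * cos (\<xi> * y))"
proof (cases "y = 0")
  case True
  then show ?thesis
    by (intro integral_nonneg integrable_continuous_interval continuous_intros) auto
next
  case False
  define F where "F = (\<lambda>\<xi>. 2 * (1 - \<xi>) * sin (\<xi> * y) / y - 2 * cos (\<xi> * y) / y\<^sup>2)"
  have "(F has_vector_derivative 2 * (1 - \<xi>) * cos (\<xi> * y)) (at \<xi> within {0..1})" for \<xi>
    unfolding F_def has_real_derivative_iff_has_vector_derivative[symmetric]
    using False by (auto intro!: derivative_eq_intros simp: field_simps power2_eq_square)
  then have "((\<lambda>\<xi>. 2 * (1 - \<xi>) * cos (\<xi> * y)) has_integral (F 1 - F 0)) {0..1}"
    by (intro fundamental_theorem_of_calculus) auto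
  moreover have "F 1 - F 0 = 2 * (1 - cos y) / y\<^sup>2"
    using False by (simp add: F_def field_simps)
  moreover have "\<dots> \<ge> 0" by simp
  ultimately show ?thesis by (metis integral_unique)
qed

text \<open>Since \<open>\<bar>\<xi> * y\<bar> \<le> 1 < pi / 3\<close>, the cosine is at least 1/2,
  so the integrand dominates \<open>1 - \<xi>\<close>, whose integral is 1/2.\<close>

lemma fejer_kernel_ge_half:
  fixes y :: real
  assumes "\<bar>y\<bar> \<le> 1"
  shows "1 / 2 \<le> integral {0..1} (\<lambda>\<xi>. 2 * (1 - \<xi>) * cos (\<xi> * y))"
proof -
  have "((\<lambda>\<xi>::real. 1 - \<xi>) has_integral ((1 - 1\<^sup>2 / 2) - (0 - 0\<^sup>2 / 2))) {0..1}"
    by (intro fundamental_theorem_of_calculus)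
      (auto intro!: derivative_eq_intros simp: has_real_derivative_iff_has_vector_derivative[symmetric])
  then have half: "integral {0..1} (\<lambda>\<xi>::real. 1 - \<xi>) = 1 / 2"
    by (simp add: integral_unique)
  have "1 - \<xi> \<le> 2 * (1 - \<xi>) * cos (\<xi> * y)" if "\<xi> \<in> {0..1}" for \<xi>
  proof -
    have "\<bar>\<xi> * y\<bar> \<le> 1"
      using that assms mult_mono[of "\<bar>\<xi>\<bar>" 1 "\<bar>y\<bar>" 1] by (auto simp: abs_mult)
    then have "cos (pi / 3) \<le> cos \<bar>\<xi> * y\<bar>"
      using pi_gt3 by (intro cos_monotone_0_pi_le) auto
    then have "1 / 2 \<le> cos (\<xi> * y)" by (simp add: cos_60)
    then have "(1 - \<xi>) * 1 \<le> (1 - \<xi>) * (2 * cos (\<xi> * y))"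
      using that by (intro mult_left_mono) auto
    then show ?thesis by (simp only: mult_1_right mult.assoc mult.left_commute[of _ 2])
  qed
  then have "integral {0..1} (\<lambda>\<xi>::real. 1 - \<xi>) \<le> integral {0..1} (\<lambda>\<xi>. 2 * (1 - \<xi>) * cos (\<xi> * y))"
    by (intro integral_le integrable_continuous_interval continuous_intros) auto
  then show ?thesis by (simp only: half)
qed

text \<open>The kernel \<open>K\<close> at \<open>(f x - c) / \<rho>\<close> is at least 1/2 on
  \<open>{s..t}\<close> and nonnegative elsewhere, so half the length is at most its integral over
  \<open>{a..b}\<close>. Swapping integrals turns this into an average over frequencies
  \<open>\<xi> / \<rho>\<close>, to which the decay applies; \<open>\<xi> powr (-\<delta>)\<close>
  is integrable near 0 because \<open>\<delta> < 1\<close>, and its integral is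
  \<open>1 / (1 - \<delta>)\<close>.\<close>

lemma sublevel_interval_bound:
  fixes f :: "real \<Rightarrow> real"
  assumes cont: "continuous_on {a..b} f" and \<delta>: "0 < \<delta>" "\<delta> < 1" and A: "A \<ge> 0"
    and decay: "\<And>\<mu>::real. \<mu> \<noteq> 0 \<Longrightarrow>
      cmod (integral {a..b} (\<lambda>x. exp (\<i> * of_real (\<mu> * f x)))) \<le> A * \<bar>\<mu>\<bar> powr (- \<delta>)"
    and st: "a \<le> s" "s \<le> t" "t \<le> b" and \<rho>: "\<rho> > 0"
    and near: "\<And>x. x \<in> {s..t} \<Longrightarrow> \<bar>f x - c\<bar> \<le> \<rho>"
  shows "t - s \<le> 4 / (1 - \<delta>) * A * \<rho> powr \<delta>"
proof -
  define K where "K = (\<lambda>y::real. integral {0..1} (\<lambda>\<xi>. 2 * (1 - \<xi>) * cos (\<xi> * y)))"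
  define g where "g = (\<lambda>x. (f x - c) / \<rho>)"
  have contg: "continuous_on {a..b} g"
    unfolding g_def by (intro continuous_intros cont) (use \<rho> in auto)
  define k where "k = (\<lambda>x \<xi>. 2 * (1 - \<xi>) * cos (\<xi> * g x))"
  have cont2: "continuous_on (cbox (a,0) (b,1)) (\<lambda>(x,\<xi>). k x \<xi>)"
  proof -
    have "continuous_on (cbox (a,0) (b,1)) (\<lambda>p. g (fst p))"
      by (rule continuous_on_compose2[OF contg]) (auto intro!: continuous_intros simp: cbox_Pair_eq)
    then show ?thesis unfolding k_def split_def by (intro continuous_intros) auto
  qed
  have swap: "integral {a..b} (\<lambda>x. integral {0..1} (k x)) = integral {0..1} (\<lambda>\<xi>. integral {a..b} (\<lambda>x. k x \<xi>))"
    using integral_swap_continuous[OF cont2] by (simp add: box_real)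
  have Kint: "(\<lambda>x. K (g x)) integrable_on {a..b}"
    using integral_integrable_2dim[OF cont2] by (simp add: K_def k_def box_real)
  have kint: "(\<lambda>\<xi>. integral {a..b} (\<lambda>x. k x \<xi>)) integrable_on {0..1}"
  proof -
    have "continuous_on (cbox (0,a) (1,b)) (\<lambda>(\<xi>,x). k x \<xi>)"
    proof -
      have "continuous_on (cbox (0,a) (1,b)) (\<lambda>p. g (snd p))"
        by (rule continuous_on_compose2[OF contg]) (auto intro!: continuous_intros simp: cbox_Pair_eq)
      then show ?thesis unfolding k_def split_def by (intro continuous_intros) auto
    qed
    from integral_integrable_2dim[OF this] show ?thesis by (simp add: box_real)
  qed
  have "(t - s) * (1 / 2) = integral {s..t} (\<lambda>x. 1 / 2)" using st by simp
  also have "\<dots> \<le> integral {s..t} (\<lambda>x. K (g x))"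
  proof (rule integral_le)
    show "(\<lambda>x. K (g x)) integrable_on {s..t}"
      by (rule integrable_on_subinterval[OF Kint]) (use st in auto)
    fix x assume "x \<in> {s..t}"
    then show "1 / 2 \<le> K (g x)"
      unfolding K_def using near[of x] \<rho> by (intro fejer_kernel_ge_half) (auto simp: g_def)
  qed auto
  also have "\<dots> \<le> integral {a..b} (\<lambda>x. K (g x))"
    by (rule integral_subset_le)
      (use st Kint integrable_on_subinterval[OF Kint] fejer_kernel_nonneg in \<open>auto simp: K_def\<close>)
  also have "\<dots> = integral {0..1} (\<lambda>\<xi>. integral {a..b} (\<lambda>x. k x \<xi>))"
    using swap by (simp add: K_def k_def)
  also have "\<dots> \<le> integral {0..1} (\<lambda>\<xi>. 2 * A * \<rho> powr \<delta> * \<xi> powr (-\<delta>))"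
  proof -
    have pw: "(\<lambda>\<xi>. \<xi> powr (-\<delta>)) integrable_on {0..1}"
      using has_integral_powr_from_0[of "-\<delta>" 1] \<delta> by (auto simp: integrable_on_def)
    have bnd: "integral {a..b} (\<lambda>x. k x \<xi>) \<le> 2 * A * \<rho> powr \<delta> * \<xi> powr (-\<delta>)"
      if "\<xi> \<in> {0..1} - {0}" for \<xi>
    proof -
      have \<xi>: "0 < \<xi>" "\<xi> \<le> 1" using that by auto
      define E where "E = (\<lambda>x. exp (\<i> * of_real (\<xi> / \<rho> * f x)))"
      \<comment> \<open>A unimodular factor that removes the constant \<open>c\<close> from the
        phase.\<close>
      define w where "w = exp (- \<i> * of_real (\<xi> / \<rho> * c))"
      have Eint: "E integrable_on {a..b}"
        unfolding E_def by (intro integrable_continuous_interval continuous_intros cont)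
      have cosE: "cos (\<xi> * g x) = Re (w * E x)" for x
      proof -
        have "w * E x = exp (\<i> * of_real (\<xi> * g x))"
          unfolding w_def E_def g_def exp_add[symmetric] using \<rho>
          by (intro arg_cong[of _ _ exp]) (simp add: field_simps)
        then show ?thesis by (simp add: Re_exp)
      qed
      have "integral {a..b} (\<lambda>x. cos (\<xi> * g x)) = Re (integral {a..b} (\<lambda>x. w * E x))"
        unfolding cosE
        using integral_linear[OF integrable_on_mult_right[OF Eint, of w] bounded_linear_Re] by (simp add: o_def)
      also have "\<dots> \<le> cmod (w * integral {a..b} E)"
        by (simp only: integral_mult_right complex_Re_le_cmod)
      also have "\<dots> = cmod (integral {a..b} E)"
        by (simp add: norm_mult w_def)
      also have "\<dots> \<le> A * \<bar>\<xi> / \<rho>\<bar> powr (-\<delta>)"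
        unfolding E_def using decay[of "\<xi> / \<rho>"] \<xi> \<rho> by auto
      also have "\<dots> = A * \<rho> powr \<delta> * \<xi> powr (-\<delta>)"
        using \<xi> \<rho> by (simp add: powr_divide powr_minus field_simps)
      finally have *: "integral {a..b} (\<lambda>x. cos (\<xi> * g x)) \<le> A * \<rho> powr \<delta> * \<xi> powr (-\<delta>)" .
      have "integral {a..b} (\<lambda>x. k x \<xi>) = 2 * (1 - \<xi>) * integral {a..b} (\<lambda>x. cos (\<xi> * g x))"
        by (simp add: k_def)
      also have "\<dots> \<le> 2 * (1 - \<xi>) * (A * \<rho> powr \<delta> * \<xi> powr (-\<delta>))"
        by (rule mult_left_mono[OF *]) (use \<xi> in auto)
      also have "\<dots> \<le> 2 * (A * \<rho> powr \<delta> * \<xi> powr (-\<delta>))"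
        by (rule mult_right_mono) (use \<xi> A in auto)
      finally show ?thesis by (simp add: mult_ac)
    qed
    have "(\<lambda>\<xi>. 2 * A * \<rho> powr \<delta> * \<xi> powr (-\<delta>)) integrable_on {0..1}"
      by (rule integrable_on_mult_right[OF pw])
    \<comment> \<open>The decay says nothing at frequency 0. The value there is replaced by 0, which
      agrees with \<open>0 powr (-\<delta>) = 0\<close> on the right-hand side.\<close>
    moreover have "(\<lambda>\<xi>. if \<xi> = 0 then 0 else integral {a..b} (\<lambda>x. k x \<xi>)) integrable_on {0..1}"
      by (rule integrable_spike_finite[OF _ _ kint, of "{0}"]) auto
    moreover have "integral {0..1} (\<lambda>\<xi>. integral {a..b} (\<lambda>x. k x \<xi>)) =
        integral {0..1} (\<lambda>\<xi>. if \<xi> = 0 then 0 else integral {a..b} (\<lambda>x. k x \<xi>))"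
      by (rule integral_spike[of "{0}"]) auto
    ultimately show ?thesis
      using bnd by (simp only:) (intro integral_le; auto)
  qed
  also have "\<dots> = 2 * A * \<rho> powr \<delta> * (1 / (1 - \<delta>))"
    using has_integral_powr_from_0[of "-\<delta>" 1] \<delta> by (simp add: integral_unique)
  finally show ?thesis by (simp add: field_simps)
qed

subsection \<open>Intervals with single-signed functions\<close>

lemma single_signed_on_mult:
  "single_signed_on S g \<Longrightarrow> single_signed_on S h \<Longrightarrow> single_signed_on S (\<lambda>x. g x * h x)"
  unfolding single_signed_on_def by (auto simp: mult_le_0_iff zero_le_mult_iff)

lemma single_signed_onE:
  assumes "single_signed_on S g"
  obtains \<sigma> :: real where "\<bar>\<sigma>\<bar> = 1" "\<And>x. x \<in> S \<Longrightarrow> \<sigma> * g x = \<bar>g x\<bar>"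
  using assms unfolding single_signed_on_def
proof
  assume "\<forall>x\<in>S. g x \<ge> 0" then show thesis by (intro that[of 1]) auto
next
  assume "\<forall>x\<in>S. g x \<le> 0" then show thesis by (intro that[of "-1"]) auto
qed

text \<open>\<open>pieces R n u v\<close> says that \<open>{u..v}\<close> is a chain of at most
  \<open>n\<close> adjacent intervals satisfying \<open>R\<close>. The inequalities in both rules
  make \<open>n\<close> an upper bound, not an exact count; degenerate intervals are
  allowed.\<close>

inductive pieces :: "(real \<Rightarrow> real \<Rightarrow> bool) \<Rightarrow> nat \<Rightarrow> real \<Rightarrow> real \<Rightarrow> bool" for R where
  single: "u \<le> v \<Longrightarrow> R u v \<Longrightarrow> 1 \<le> n \<Longrightarrow> pieces R n u v"
| join: "pieces R n u t \<Longrightarrow> pieces R k t v \<Longrightarrow> n + k \<le> l \<Longrightarrow> pieces R l u v"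

lemma pieces_le: "pieces R n u v \<Longrightarrow> u \<le> v"
  by (induction rule: pieces.induct) auto

lemma pieces_mono:
  assumes "pieces R n u v" "n \<le> k"
  shows "pieces R k u v"
  using assms(1)
proof cases
  case single
  then show ?thesis using assms(2) by (intro pieces.single) auto
next
  case (join n' t k')
  then show ?thesis using assms(2) by (intro pieces.join[OF join(1,2)]) auto
qed

lemma pieces_refine:
  assumes "pieces R n u v"
    and "\<And>s t. u \<le> s \<Longrightarrow> s \<le> t \<Longrightarrow> t \<le> v \<Longrightarrow> R s t \<Longrightarrow> pieces S k s t"
  shows "pieces S (n * k) u v"
  using assms
proof (induction rule: pieces.induct)
  case (single u v n)
  then have "pieces S k u v" by auto
  then show ?case by (rule pieces_mono) (use single in auto)
next
  case (join n u t k' v l)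
  have "pieces S (n * k) u t" "pieces S (k' * k) t v"
    using pieces_le[OF join.hyps(1)] pieces_le[OF join.hyps(2)] by (intro join.IH join.prems; simp)+
  moreover have "n * k + k' * k \<le> l * k"
    using join.hyps(3) by (metis add_mult_distrib mult_le_mono1)
  ultimately show ?case by (rule pieces.join)
qed

lemma pieces_integral_bound:
  fixes h :: "real \<Rightarrow> complex"
  assumes "pieces R n u v" and "h integrable_on {u..v}" and "B \<ge> 0"
    and "\<And>s t. u \<le> s \<Longrightarrow> s \<le> t \<Longrightarrow> t \<le> v \<Longrightarrow> R s t \<Longrightarrow> cmod (integral {s..t} h) \<le> B"
  shows "cmod (integral {u..v} h) \<le> real n * B"
  using assms
proof (induction rule: pieces.induct)
  case (single u v n)
  then have "cmod (integral {u..v} h) \<le> 1 * B" by auto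
  also have "\<dots> \<le> real n * B" using single by (intro mult_right_mono) auto
  finally show ?case .
next
  case (join n u t k v l)
  note le = pieces_le[OF join.hyps(1)] pieces_le[OF join.hyps(2)]
  have "h integrable_on {u..t}" "h integrable_on {t..v}"
    using integrable_on_subinterval[OF join.prems(1)] le by auto
  then have "cmod (integral {u..t} h) \<le> real n * B" "cmod (integral {t..v} h) \<le> real k * B"
    using le by (intro join.IH join.prems; simp)+
  moreover have "integral {u..v} h = integral {u..t} h + integral {t..v} h"
    using Henstock_Kurzweil_Integration.integral_combine[OF le join.prems(1)] by simp
  ultimately have "cmod (integral {u..v} h) \<le> real n * B + real k * B"
    by (metis add_mono norm_triangle_ineq order_trans)
  also have "\<dots> = real (n + k) * B" by (simp add: algebra_simps)
  also have "\<dots> \<le> real l * B" using join by (intro mult_right_mono) auto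
  finally show ?case .
qed

section \<open>Families of functions with simultaneous signs\<close>

definition single_signed_all :: "(real \<Rightarrow> real) set \<Rightarrow> real \<Rightarrow> real \<Rightarrow> bool" where
  "single_signed_all G u v \<longleftrightarrow> (\<forall>g\<in>G. single_signed_on {u..v} g)"

lemma single_signed_on_subset:
  "single_signed_on S g \<Longrightarrow> T \<subseteq> S \<Longrightarrow> single_signed_on T g"
  by (auto simp: single_signed_on_def)

lemma single_signed_all_subinterval:
  "single_signed_all G u v \<Longrightarrow> u \<le> s \<Longrightarrow> t \<le> v \<Longrightarrow> single_signed_all G s t"
  unfolding single_signed_all_def by (auto elim!: single_signed_on_subset)

text \<open>Signs survive passing to subintervals, so the family can be enlarged one function at a
  time, and the splitting for \<open>g\<close> may rely on the signs already secured.\<close>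

lemma pieces_insert:
  assumes "pieces (single_signed_all G) n u v"
    and "\<And>s t. u \<le> s \<Longrightarrow> s \<le> t \<Longrightarrow> t \<le> v \<Longrightarrow> single_signed_all G s t \<Longrightarrow>
      pieces (\<lambda>s t. single_signed_on {s..t} g) k s t"
  shows "pieces (single_signed_all (insert g G)) (n * k) u v"
proof (rule pieces_refine[OF assms(1)])
  fix s t assume st: "u \<le> s" "s \<le> t" "t \<le> v" and G: "single_signed_all G s t"
  have "pieces (single_signed_all (insert g G)) (k * 1) s t"
  proof (rule pieces_refine[OF assms(2)[OF st G]])
    fix s' t' assume *: "s \<le> s'" "s' \<le> t'" "t' \<le> t" "single_signed_on {s'..t'} g"
    show "pieces (single_signed_all (insert g G)) 1 s' t'"
      using * single_signed_all_subinterval[OF G] 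
      by (intro pieces.single) (auto simp: single_signed_all_def)
  qed
  then show "pieces (single_signed_all (insert g G)) k s t" by simp
qed

text \<open>A continuous increasing function changes sign at most once, at a zero supplied by the
  intermediate value theorem; if 0 does not lie between the end values, no cut is necessary.\<close>

lemma pieces_of_mono:
  fixes g :: "real \<Rightarrow> real"
  assumes "u \<le> v" "continuous_on {u..v} g" "mono_on {u..v} g"
  shows "pieces (\<lambda>s t. single_signed_on {s..t} g) 2 u v"
proof (cases "g u \<le> 0 \<and> 0 \<le> g v")
  case True
  then obtain z where z: "u \<le> z" "z \<le> v" "g z = 0"
    using IVT'[of g u 0 v] assms by auto
  have "single_signed_on {u..z} g" "single_signed_on {z..v} g"
    unfolding single_signed_on_def
    using mono_onD[OF assms(3), of _ z] mono_onD[OF assms(3), of z] z by auto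
  then show ?thesis
    using z by (intro pieces.join[of _ 1 u z 1 v 2] pieces.single) auto
next
  case False
  then have "single_signed_on {u..v} g"
    unfolding single_signed_on_def
    using mono_onD[OF assms(3), of _ v] mono_onD[OF assms(3), of u] assms(1) by fastforce
  then show ?thesis
    using assms(1) by (intro pieces.single) auto
qed

text \<open>By the mean value theorem \<open>g\<close> or \<open>-g\<close> is increasing, and being
  single-signed is invariant under negation.\<close>

lemma pieces_of_single_signed_deriv:
  fixes g g' :: "real \<Rightarrow> real"
  assumes uv: "u \<le> v"
    and der: "\<And>x. x \<in> {u..v} \<Longrightarrow> (g has_real_derivative g' x) (at x within {u..v})"
    and ss: "single_signed_on {u..v} g'"
  shows "pieces (\<lambda>s t. single_signed_on {s..t} g) 2 u v"
proof -
  have mono: "mono_on {u..v} h"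
    if d: "\<And>x. x \<in> {u..v} \<Longrightarrow> (h has_real_derivative h' x) (at x within {u..v})"
      and p: "\<And>x. x \<in> {u..v} \<Longrightarrow> h' x \<ge> 0" for h h' :: "real \<Rightarrow> real"
  proof (rule mono_onI)
    fix x y assume xy: "x \<in> {u..v}" "y \<in> {u..v}" "x \<le> y"
    have der': "(h has_derivative (\<lambda>w. w * h' z)) (at z within {x..y})" if "x \<le> z" "z \<le> y" for z
      using DERIV_subset[OF d, of z "{x..y}"] xy that
      by (auto simp: has_field_derivative_def mult_commute_abs)
    show "h x \<le> h y"
    proof (cases "x = y")
      case False
      from mvt_very_simple[OF xy(3) der'] obtain z where z: "z \<in> {x..y}" "h y - h x = (y - x) * h' z"
        by blast
      then have "0 \<le> h' z" using xy p by auto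
      then have "0 \<le> (y - x) * h' z" using xy by simp
      then show ?thesis using z by simp
    qed simp
  qed
  have cont: "continuous_on {u..v} g"
    by (rule DERIV_continuous_on[OF der])
  show ?thesis
    using ss unfolding single_signed_on_def[of _ g']
  proof
    assume "\<forall>x\<in>{u..v}. g' x \<ge> 0"
    then show ?thesis by (intro pieces_of_mono uv cont mono[OF der]) auto
  next
    assume "\<forall>x\<in>{u..v}. g' x \<le> 0"
    then have "mono_on {u..v} (\<lambda>x. - g x)"
      by (intro mono[OF DERIV_minus[OF der]]) auto
    then have "pieces (\<lambda>s t. single_signed_on {s..t} (\<lambda>x. - g x)) 2 u v"
      by (intro pieces_of_mono uv cont continuous_intros)
    then show ?thesis by (simp add: single_signed_on_def disj_commute)
  qed
qed

text \<open>Induction on the degree: the derivative of \<open>poly Q (f x)\<close> is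
  \<open>poly (pderiv Q) (f x) * f1 x\<close>, a product of single-signed factors once the interval
  is split for \<open>pderiv Q\<close>. Each degree doubles the count.\<close>

lemma pieces_poly_compose:
  fixes f f1 :: "real \<Rightarrow> real" and Q :: "real poly"
  assumes "u \<le> v"
    and "\<And>x. x \<in> {u..v} \<Longrightarrow> (f has_real_derivative f1 x) (at x within {u..v})"
    and "single_signed_on {u..v} f1" and "degree Q \<le> m"
  shows "pieces (\<lambda>s t. single_signed_on {s..t} (\<lambda>x. poly Q (f x))) (2 ^ m) u v"
  using assms
proof (induction m arbitrary: Q)
  case 0
  then obtain c where "Q = [:c:]" by (meson degree_eq_zeroE le_zero_eq)
  then show ?case using 0 by (intro pieces.single) (auto simp: single_signed_on_def)
next
  case (Suc m)
  have "pieces (\<lambda>s t. single_signed_on {s..t} (\<lambda>x. poly (pderiv Q) (f x))) (2 ^ m) u v"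
    by (rule Suc.IH) (use Suc.prems in \<open>auto simp: degree_pderiv\<close>)
  then have "pieces (\<lambda>s t. single_signed_on {s..t} (\<lambda>x. poly Q (f x))) (2 ^ m * 2) u v"
  proof (rule pieces_refine)
    fix s t assume st: "u \<le> s" "s \<le> t" "t \<le> v"
      and ss: "single_signed_on {s..t} (\<lambda>x. poly (pderiv Q) (f x))"
    show "pieces (\<lambda>s t. single_signed_on {s..t} (\<lambda>x. poly Q (f x))) 2 s t"
    proof (rule pieces_of_single_signed_deriv[OF st(2), where g' = "\<lambda>x. poly (pderiv Q) (f x) * f1 x"])
      fix x assume "x \<in> {s..t}"
      then show "((\<lambda>x. poly Q (f x)) has_real_derivative poly (pderiv Q) (f x) * f1 x) (at x within {s..t})"
        using st by (intro DERIV_chain2[where f = "poly Q", OF poly_DERIV] DERIV_subset[OF Suc.prems(2)]) auto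
    next
      have "single_signed_on {s..t} f1"
        by (rule single_signed_on_subset[OF Suc.prems(3)]) (use st in auto)
      with ss show "single_signed_on {s..t} (\<lambda>x. poly (pderiv Q) (f x) * f1 x)"
        by (rule single_signed_on_mult)
    qed
  qed
  then show ?case by (simp add: mult.commute)
qed

text \<open>Descends from order \<open>k + j\<close> to order \<open>k\<close> one derivative at a
  time, doubling the count at each step.\<close>

lemma pieces_higher_deriv:
  assumes "a \<le> b" and sm: "smooth_on {a..b} f"
    and "single_signed_on {a..b} (higher_deriv_on {a..b} (k + j) f)"
  shows "pieces (\<lambda>s t. single_signed_on {s..t} (higher_deriv_on {a..b} k f)) (2 ^ j) a b"
  using assms(3)
proof (induction j arbitrary: k)
  case 0
  then show ?case using assms by (intro pieces.single) auto
next
  case (Suc j)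
  then have "pieces (\<lambda>s t. single_signed_on {s..t} (higher_deriv_on {a..b} (Suc k) f)) (2 ^ j) a b"
    using Suc.IH[of "Suc k"] Suc.prems by (simp only: add_Suc add_Suc_right)
  then have "pieces (\<lambda>s t. single_signed_on {s..t} (higher_deriv_on {a..b} k f)) (2 ^ j * 2) a b"
  proof (rule pieces_refine)
    fix s t assume st: "a \<le> s" "s \<le> t" "t \<le> b"
      and ss: "single_signed_on {s..t} (higher_deriv_on {a..b} (Suc k) f)"
    show "pieces (\<lambda>s t. single_signed_on {s..t} (higher_deriv_on {a..b} k f)) 2 s t"
    proof (rule pieces_of_single_signed_deriv[OF st(2) _ ss])
      fix x assume "x \<in> {s..t}"
      then show "(higher_deriv_on {a..b} k f has_real_derivative higher_deriv_on {a..b} (Suc k) f x) (at x within {s..t})"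
        using st by (intro DERIV_subset[OF smooth_on_has_real_derivative[OF sm]]) auto
    qed
  qed
  then show ?case by (simp add: mult.commute)
qed

text \<open>The two signs fix the position of \<open>g\<close> relative to both \<open>k\<close> and
  \<open>-k\<close> on all of \<open>S\<close>. Thus a size dichotomy for
  \<open>\<bar>g\<bar>\<close> is encoded by sign conditions.\<close>

lemma single_signed_on_shift_cases:
  assumes "single_signed_on S (\<lambda>x. g x - k)" "single_signed_on S (\<lambda>x. g x + k)"
  obtains "\<And>x. x \<in> S \<Longrightarrow> k \<le> \<bar>g x\<bar>" | "\<And>x. x \<in> S \<Longrightarrow> \<bar>g x\<bar> \<le> k"
proof -
  have "(\<forall>x\<in>S. k \<le> \<bar>g x\<bar>) \<or> (\<forall>x\<in>S. \<bar>g x\<bar> \<le> k)"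
    using assms unfolding single_signed_on_def by (smt (verit, best))
  with that show thesis by blast
qed

lemma smooth_on_deriv_subinterval:
  assumes "smooth_on {a..b} f" "a \<le> s" "t \<le> b" "x \<in> {s..t}"
  shows "(higher_deriv_on {a..b} n f has_real_derivative higher_deriv_on {a..b} (Suc n) f x) (at x within {s..t})"
  by (rule DERIV_subset[OF smooth_on_has_real_derivative[OF assms(1)]]) (use assms in auto)

text \<open>The functions are added in the order \<open>f2\<close>, \<open>f1\<close>,
  \<open>f1 - \<kappa>\<close>, \<open>f1 + \<kappa>\<close>, then the three polynomials in
  \<open>f\<close>, so that each splitting uses only signs already available. The factors are
  \<open>2 ^ (N - 2)\<close> for \<open>f2\<close>, three doublings, and three times
  \<open>2 ^ m\<close>. It is applied with \<open>Q = pderiv P\<close>.\<close>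

lemma pieces_decomposition:
  fixes f :: "real \<Rightarrow> real" and Q :: "real poly"
  assumes "N \<ge> 2" "a \<le> b" and sm: "smooth_on {a..b} f"
    and ss: "single_signed_on {a..b} (higher_deriv_on {a..b} N f)"
    and m: "degree Q \<le> m"
    and f1: "f1 = higher_deriv_on {a..b} 1 f" and f2: "f2 = higher_deriv_on {a..b} 2 f"
  shows "pieces (single_signed_all {\<lambda>x. poly Q (f x) + \<epsilon>, \<lambda>x. poly Q (f x) - \<epsilon>,
      \<lambda>x. poly (pderiv Q) (f x), \<lambda>x. f1 x + \<kappa>, \<lambda>x. f1 x - \<kappa>, f1, f2})
    (2 ^ (N + 1) * (2 ^ m) ^ 3) a b"
proof -
  have df: "(f has_real_derivative f1 x) (at x within {s..t})"
    if "a \<le> s" "t \<le> b" "x \<in> {s..t}" for s t x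
    using smooth_on_deriv_subinterval[OF sm that, of 0] by (simp add: f1)
  have df1: "(f1 has_real_derivative f2 x) (at x within {s..t})"
    if "a \<le> s" "t \<le> b" "x \<in> {s..t}" for s t x
    using smooth_on_deriv_subinterval[OF sm that, of 1] by (simp add: f1 f2 numeral_2_eq_2)
  have shift: "pieces (\<lambda>s t. single_signed_on {s..t} (\<lambda>x. f1 x + k)) 2 s t"
    if "a \<le> s" "s \<le> t" "t \<le> b" "single_signed_all G s t" "f2 \<in> G" for s t k G
  proof (rule pieces_of_single_signed_deriv[OF that(2)])
    show "((\<lambda>x. f1 x + k) has_real_derivative f2 x) (at x within {s..t})" if "x \<in> {s..t}" for x
      using DERIV_add[OF df1 DERIV_const[of k]] \<open>a \<le> s\<close> \<open>t \<le> b\<close> that by simp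
    show "single_signed_on {s..t} f2" using that by (auto simp: single_signed_all_def)
  qed
  have poly: "pieces (\<lambda>s t. single_signed_on {s..t} (\<lambda>x. poly R (f x))) (2 ^ m) s t"
    if "a \<le> s" "s \<le> t" "t \<le> b" "single_signed_all G s t" "f1 \<in> G" "degree R \<le> m" for s t R G
  proof (rule pieces_poly_compose[OF that(2) _ _ that(6)])
    show "(f has_real_derivative f1 x) (at x within {s..t})" if "x \<in> {s..t}" for x
      by (rule df) (use \<open>a \<le> s\<close> \<open>t \<le> b\<close> that in auto)
    show "single_signed_on {s..t} f1" using that by (auto simp: single_signed_all_def)
  qed
  have "single_signed_on {a..b} (higher_deriv_on {a..b} (2 + (N - 2)) f)"
    using ss \<open>N \<ge> 2\<close> by (simp only: le_add_diff_inverse)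
  from pieces_higher_deriv[OF \<open>a \<le> b\<close> sm this]
  have 0: "pieces (single_signed_all {f2}) (2 ^ (N - 2)) a b"
    by (simp add: single_signed_all_def[abs_def] f2)
  have 1: "pieces (single_signed_all {f1, f2}) (2 ^ (N - 2) * 2) a b"
    by (rule pieces_insert[OF 0]) (use shift[where k = 0] in simp)
  have 2: "pieces (single_signed_all {\<lambda>x. f1 x - \<kappa>, f1, f2}) (2 ^ (N - 2) * 2 * 2) a b"
    by (rule pieces_insert[OF 1]) (use shift[where k = "-\<kappa>"] in simp)
  have 3: "pieces (single_signed_all {\<lambda>x. f1 x + \<kappa>, \<lambda>x. f1 x - \<kappa>, f1, f2}) (2 ^ (N - 2) * 2 * 2 * 2) a b"
    by (rule pieces_insert[OF 2]) (use shift[where k = "\<kappa>"] in simp)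
  have 4: "pieces (single_signed_all {\<lambda>x. poly (pderiv Q) (f x), \<lambda>x. f1 x + \<kappa>, \<lambda>x. f1 x - \<kappa>, f1, f2})
      (2 ^ (N - 2) * 2 * 2 * 2 * 2 ^ m) a b"
    by (rule pieces_insert[OF 3], rule poly) (use m in \<open>auto simp: degree_pderiv\<close>)
  have eq: "poly (Q - [:\<epsilon>:]) (f x) = poly Q (f x) - \<epsilon>" "poly (Q + [:\<epsilon>:]) (f x) = poly Q (f x) + \<epsilon>" for x
    by simp_all
  have deg: "degree (Q - [:\<epsilon>:]) \<le> m" "degree (Q + [:\<epsilon>:]) \<le> m"
    using m by (auto intro!: degree_diff_le degree_add_le)
  have 5: "pieces (single_signed_all {\<lambda>x. poly Q (f x) - \<epsilon>, \<lambda>x. poly (pderiv Q) (f x),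
      \<lambda>x. f1 x + \<kappa>, \<lambda>x. f1 x - \<kappa>, f1, f2}) (2 ^ (N - 2) * 2 * 2 * 2 * 2 ^ m * 2 ^ m) a b"
    by (rule pieces_insert[OF 4], rule poly[where R = "Q - [:\<epsilon>:]", unfolded eq]) (use deg in auto)
  have 6: "pieces (single_signed_all {\<lambda>x. poly Q (f x) + \<epsilon>, \<lambda>x. poly Q (f x) - \<epsilon>, \<lambda>x. poly (pderiv Q) (f x),
      \<lambda>x. f1 x + \<kappa>, \<lambda>x. f1 x - \<kappa>, f1, f2}) (2 ^ (N - 2) * 2 * 2 * 2 * 2 ^ m * 2 ^ m * 2 ^ m) a b"
    by (rule pieces_insert[OF 5], rule poly[where R = "Q + [:\<epsilon>:]", unfolded eq]) (use deg in auto)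
  obtain n where "N = n + 2" using \<open>N \<ge> 2\<close> by (metis add.commute le_Suc_ex)
  then show ?thesis using 6 by (simp add: power3_eq_cube mult_ac)
qed

subsection \<open>Lower bounds for polynomials on short intervals\<close>

definition coeff_norm :: "real poly \<Rightarrow> real" where
  "coeff_norm p = (\<Sum>i\<le>degree p. \<bar>coeff p i\<bar>)"

lemma coeff_norm_altdef:
  assumes "degree p \<le> n"
  shows "coeff_norm p = (\<Sum>i\<le>n. \<bar>coeff p i\<bar>)"
  unfolding coeff_norm_def using assms
  by (intro sum.mono_neutral_left) (auto simp: coeff_eq_0)

lemma coeff_norm_nonneg: "coeff_norm p \<ge> 0"
  by (simp add: coeff_norm_def sum_nonneg)

lemma abs_coeff_le_coeff_norm: "\<bar>coeff p i\<bar> \<le> coeff_norm p"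
proof -
  have "coeff_norm p = (\<Sum>j\<le>max i (degree p). \<bar>coeff p j\<bar>)"
    by (intro coeff_norm_altdef) simp
  then show ?thesis
    using member_le_sum[of i "{..max i (degree p)}" "\<lambda>j. \<bar>coeff p j\<bar>"] by simp
qed

lemma coeff_norm_pCons: "coeff_norm (pCons a p) = \<bar>a\<bar> + coeff_norm p"
  using coeff_norm_altdef[of "pCons a p" "Suc (degree p)"] degree_pCons_le[of a p]
  by (simp add: coeff_norm_def sum.atMost_Suc_shift del: sum.atMost_Suc)

lemma coeff_norm_add: "coeff_norm (p + q) \<le> coeff_norm p + coeff_norm q"
proof -
  let ?n = "max (degree p) (degree q)"
  have "(\<Sum>i\<le>?n. \<bar>coeff p i + coeff q i\<bar>) \<le> (\<Sum>i\<le>?n. \<bar>coeff p i\<bar>) + (\<Sum>i\<le>?n. \<bar>coeff q i\<bar>)"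
    unfolding sum.distrib[symmetric] by (intro sum_mono) simp
  then show ?thesis
    using coeff_norm_altdef[of "p + q" ?n] coeff_norm_altdef[of p ?n] coeff_norm_altdef[of q ?n]
    by (simp add: degree_add_le_max)
qed

lemma coeff_norm_smult: "coeff_norm (smult c p) = \<bar>c\<bar> * coeff_norm p"
  using coeff_norm_altdef[of "smult c p" "degree p"]
  by (simp add: coeff_norm_def abs_mult sum_distrib_left degree_smult_le)

text \<open>Horner's scheme: \<open>a + x * p\<close> becomes \<open>a + (c + d * x)\<close> times
  the composed \<open>p\<close>, so each degree costs a factor
  \<open>\<bar>c\<bar> + \<bar>d\<bar> \<le> K\<close>.\<close>

lemma coeff_norm_pcompose_linear:
  assumes "degree p \<le> n" "\<bar>c\<bar> + \<bar>d\<bar> \<le> K" "1 \<le> K"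
  shows "coeff_norm (p \<circ>\<^sub>p [:c, d:]) \<le> K ^ n * coeff_norm p"
proof -
  have "coeff_norm (p \<circ>\<^sub>p [:c, d:]) \<le> K ^ degree p * coeff_norm p"
  proof (induction p)
    case (pCons a p)
    show ?case
    proof (cases "p = 0")
      case False
      let ?q = "p \<circ>\<^sub>p [:c, d:]"
      have "pCons a p \<circ>\<^sub>p [:c, d:] = smult c ?q + pCons a (smult d ?q)"
        by (simp add: pcompose_pCons)
      then have "coeff_norm (pCons a p \<circ>\<^sub>p [:c, d:]) \<le> \<bar>a\<bar> + (\<bar>c\<bar> + \<bar>d\<bar>) * coeff_norm ?q"
        using coeff_norm_add[of "smult c ?q" "pCons a (smult d ?q)"]
        by (simp add: coeff_norm_pCons coeff_norm_smult algebra_simps)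
      also have "\<dots> \<le> K ^ Suc (degree p) * \<bar>a\<bar> + K * (K ^ degree p * coeff_norm p)"
        using assms(2,3) pCons.IH coeff_norm_nonneg
        by (intro add_mono mult_mono mult_right_le_one_le)
          (auto simp del: power_Suc simp: mult_le_cancel_right1 intro: one_le_power)
      finally show ?thesis using False by (simp add: coeff_norm_pCons algebra_simps)
    qed simp
  qed (simp add: coeff_norm_def)
  also have "\<dots> \<le> K ^ n * coeff_norm p"
    using assms by (intro mult_right_mono power_increasing coeff_norm_nonneg)
  finally show ?thesis .
qed

text \<open>Induction on the degree. Writing \<open>p = c + x * q\<close> with
  \<open>c = p(0)\<close>, one has \<open>\<bar>x * q\<bar> \<le> 2 * M\<close>; on [1/2, 1]
  division by \<open>x\<close> gives \<open>\<bar>q\<bar> \<le> 4 * M\<close>. That half interval is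
  rescaled to [0, 1] for the induction hypothesis.\<close>

lemma coeff_norm_le_of_bounded:
  "\<exists>C>0. \<forall>p M. degree p \<le> m \<longrightarrow> (\<forall>x\<in>{0..1}. \<bar>poly p x\<bar> \<le> M) \<longrightarrow> coeff_norm p \<le> C * M"
proof (induction m)
  case 0
  have "coeff_norm p \<le> 1 * M" if "degree p \<le> 0" "\<forall>x\<in>{0..1}. \<bar>poly p x\<bar> \<le> M" for p M
  proof -
    from that(1) obtain c where "p = [:c:]" by (meson degree_eq_zeroE le_zero_eq)
    then show ?thesis using that(2) by (auto simp: coeff_norm_def)
  qed
  then show ?case using zero_less_one by blast
next
  case (Suc m)
  then obtain C where C: "C > 0"
    "\<And>p M. degree p \<le> m \<Longrightarrow> (\<forall>x\<in>{0..1}. \<bar>poly p x\<bar> \<le> M) \<Longrightarrow> coeff_norm p \<le> C * M"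
    by blast
  have "coeff_norm p \<le> (1 + 3 ^ m * (C * 4)) * M"
    if p: "degree p \<le> Suc m" "\<forall>x\<in>{0..1}. \<bar>poly p x\<bar> \<le> M" for p M
  proof -
    obtain c q where pq: "p = pCons c q" by (rule pCons_cases)
    have dq: "degree q \<le> m" using p(1) by (auto simp: pq split: if_splits)
    have c: "\<bar>c\<bar> \<le> M" using p(2)[rule_format, of 0] by (simp add: pq)
    define q' where "q' = q \<circ>\<^sub>p [:1/2, 1/2:]"
    have "\<bar>poly q' x\<bar> \<le> 4 * M" if "x \<in> {0..1}" for x
    proof -
      define z where "z = 1/2 + x * (1/2)"
      have z: "1/2 \<le> z" "z \<le> 1" using that by (auto simp: z_def)
      have "z * poly q z = poly p z - c" by (simp add: pq)
      then have "z * \<bar>poly q z\<bar> \<le> 2 * M"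
        using p(2)[rule_format, of z] z c abs_triangle_ineq4[of "poly p z" c]
        by (metis abs_mult abs_of_pos add_mono atLeastAtMost_iff dual_order.trans
            half_gt_zero_iff less_eq_real_def less_le_trans mult_2 zero_less_one)
      moreover have "1/2 * \<bar>poly q z\<bar> \<le> z * \<bar>poly q z\<bar>" using z by (intro mult_right_mono) auto
      ultimately show ?thesis by (simp add: q'_def poly_pcompose z_def)
    qed
    moreover have "degree q' \<le> m" using dq by (simp add: q'_def degree_pcompose)
    ultimately have q': "coeff_norm q' \<le> C * (4 * M)" using C(2) by blast
    \<comment> \<open>The inverse substitution \<open>2 * x - 1\<close>; its coefficients account
      for the base \<open>3 = 1 + 2\<close>.\<close>
    have "q = q' \<circ>\<^sub>p [:-1, 2:]"
      unfolding q'_def pcompose_assoc[symmetric] by (simp add: pcompose_pCons)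
    then have "coeff_norm q \<le> 3 ^ m * coeff_norm q'"
      using coeff_norm_pcompose_linear[OF \<open>degree q' \<le> m\<close>, of "-1" 2 3] by simp
    also have "\<dots> \<le> 3 ^ m * (C * (4 * M))" using q' by (intro mult_left_mono) auto
    finally show ?thesis using c by (simp add: pq coeff_norm_pCons algebra_simps)
  qed
  moreover have "1 + 3 ^ m * (C * 4) > 0" using C(1) by (simp add: add_pos_nonneg)
  ultimately show ?case by blast
qed

lemma coeff_pcompose_scale: "coeff (p \<circ>\<^sub>p [:0, r:]) i = r ^ i * coeff p i" for r :: real
  using coeff_pcompose_linear[of p r i] by simp

text \<open>The coefficients of \<open>Q \<circ>\<^sub>p [:y, 1:]\<close> are the Taylor
  coefficients of \<open>Q\<close> at \<open>y\<close>. Stretching [0, 1] to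
  \<open>{y..y + r}\<close> multiplies the \<open>i\<close>-th one by \<open>r ^ i\<close>.\<close>

lemma taylor_coeff_bound_of_bounded:
  "\<exists>C>0. \<forall>(Q::real poly) r y e i. degree Q \<le> m \<longrightarrow> 0 < r \<longrightarrow> (\<forall>x\<in>{y..y + r}. \<bar>poly Q x\<bar> \<le> e) \<longrightarrow>
     r ^ i * \<bar>coeff (Q \<circ>\<^sub>p [:y, 1:]) i\<bar> \<le> C * e"
proof -
  obtain C where C: "C > 0"
    "\<And>p M. degree p \<le> m \<Longrightarrow> (\<forall>x\<in>{0..1}. \<bar>poly p x\<bar> \<le> M) \<Longrightarrow> coeff_norm p \<le> C * M"
    using coeff_norm_le_of_bounded by blast
  have "r ^ i * \<bar>coeff (Q \<circ>\<^sub>p [:y, 1:]) i\<bar> \<le> C * e"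
    if Q: "degree Q \<le> m" and r: "0 < r" and b: "\<forall>x\<in>{y..y + r}. \<bar>poly Q x\<bar> \<le> e" for Q r y e i
  proof -
    let ?p = "Q \<circ>\<^sub>p [:y, 1:] \<circ>\<^sub>p [:0, r:]"
    have "r ^ i * \<bar>coeff (Q \<circ>\<^sub>p [:y, 1:]) i\<bar> = \<bar>coeff ?p i\<bar>"
      using r by (simp add: coeff_pcompose_scale abs_mult)
    also have "\<dots> \<le> coeff_norm ?p" by (rule abs_coeff_le_coeff_norm)
    also have "\<dots> \<le> C * e"
    proof (rule C(2))
      show "degree ?p \<le> m" using Q r by (simp add: degree_pcompose)
      show "\<forall>x\<in>{0..1}. \<bar>poly ?p x\<bar> \<le> e"
        using b r by (auto simp: poly_pcompose mult_left_le_one_le mult.commute)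
    qed
    finally show ?thesis .
  qed
  with C(1) show ?thesis by blast
qed

text \<open>The top Taylor coefficient is 1 at every point, so the Taylor bound with
  \<open>i = m\<close> rules out a bound \<open>r ^ m / (2 * C)\<close> on the interval.\<close>

lemma monic_large_on_interval:
  "\<exists>c>0. \<forall>(Q::real poly) r y. degree Q = m \<longrightarrow> lead_coeff Q = 1 \<longrightarrow> 0 < r \<longrightarrow>
     (\<exists>x\<in>{y..y + r}. \<bar>poly Q x\<bar> > c * r ^ m)"
proof -
  obtain C where C: "C > 0"
    "\<And>(Q::real poly) r y e i. degree Q \<le> m \<Longrightarrow> 0 < r \<Longrightarrow> (\<forall>x\<in>{y..y + r}. \<bar>poly Q x\<bar> \<le> e) \<Longrightarrow>
     r ^ i * \<bar>coeff (Q \<circ>\<^sub>p [:y, 1:]) i\<bar> \<le> C * e"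
    using taylor_coeff_bound_of_bounded[of m] by blast
  have "\<exists>x\<in>{y..y + r}. \<bar>poly Q x\<bar> > 1 / (2 * C) * r ^ m"
    if Q: "degree Q = m" "lead_coeff Q = 1" and r: "0 < r" for Q :: "real poly" and r y
  proof (rule ccontr)
    assume "\<not> ?thesis"
    then have "r ^ m * \<bar>coeff (Q \<circ>\<^sub>p [:y, 1:]) m\<bar> \<le> C * (1 / (2 * C) * r ^ m)"
      using Q r by (intro C(2)) (auto simp: not_less)
    moreover have "coeff (Q \<circ>\<^sub>p [:y, 1:]) m = 1"
      using lead_coeff_comp[of "[:y, 1:]" Q] Q by (simp add: degree_pcompose)
    ultimately show False using C(1) r by simp
  qed
  then show ?thesis using C(1) by (intro exI[of _ "1 / (2 * C)"]) auto
qed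

text \<open>A polynomial of degree at most \<^term>\<open>k + n\<close> is determined by its coefficients below
  \<^term>\<open>k\<close> and its Taylor coefficients at 1 up to order \<^term>\<open>n\<close>, because \<^term>\<open>x ^ k\<close> and
  \<^term>\<open>(x - 1) ^ Suc n\<close> are coprime.\<close>

lemma coeff_bound_two_point:
  "\<exists>C>0. \<forall>p::real poly. degree p \<le> k + n \<longrightarrow>
     \<bar>coeff p k\<bar> \<le> C * ((\<Sum>j<k. \<bar>coeff p j\<bar>) + (\<Sum>i\<le>n. \<bar>coeff (p \<circ>\<^sub>p [:1, 1:]) i\<bar>))"
proof (induction k)
  case 0
  have "\<bar>coeff p 0\<bar> \<le> 1 * ((\<Sum>j<0. \<bar>coeff p j\<bar>) + (\<Sum>i\<le>n. \<bar>coeff (p \<circ>\<^sub>p [:1, 1:]) i\<bar>))"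
    if "degree p \<le> 0 + n" for p :: "real poly"
  proof -
    let ?q = "p \<circ>\<^sub>p [:1, 1:]"
    have dq: "degree ?q \<le> n" using that by (simp add: degree_pcompose)
    \<comment> \<open>The value at 0 is read off the Taylor expansion at 1, at displacement
      -1.\<close>
    have "coeff p 0 = poly ?q (-1)" by (simp add: poly_pcompose poly_0_coeff_0)
    also have "\<dots> = (\<Sum>i\<le>n. coeff ?q i * (-1) ^ i)"
      unfolding poly_altdef using dq by (intro sum.mono_neutral_left) (auto simp: coeff_eq_0)
    finally have "\<bar>coeff p 0\<bar> \<le> (\<Sum>i\<le>n. \<bar>coeff ?q i * (-1) ^ i\<bar>)"
      by (metis sum_abs)
    then show ?thesis by (simp add: abs_mult power_abs)
  qed
  then show ?case using zero_less_one by blast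
next
  case (Suc k)
  then obtain C where C: "C > 0"
    "\<And>p::real poly. degree p \<le> k + n \<Longrightarrow>
     \<bar>coeff p k\<bar> \<le> C * ((\<Sum>j<k. \<bar>coeff p j\<bar>) + (\<Sum>i\<le>n. \<bar>coeff (p \<circ>\<^sub>p [:1, 1:]) i\<bar>))"
    by blast
  have "\<bar>coeff p (Suc k)\<bar> \<le>
      C * (real n + 1) * ((\<Sum>j<Suc k. \<bar>coeff p j\<bar>) + (\<Sum>i\<le>n. \<bar>coeff (p \<circ>\<^sub>p [:1, 1:]) i\<bar>))"
    if p: "degree p \<le> Suc k + n" for p :: "real poly"
  proof -
    obtain c q where pq: "p = pCons c q" by (rule pCons_cases)
    have dq: "degree q \<le> k + n" using p by (auto simp: pq split: if_splits)
    let ?q = "q \<circ>\<^sub>p [:1, 1:]" and ?p = "p \<circ>\<^sub>p [:1, 1:]"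
    let ?S = "\<Sum>i\<le>n. \<bar>coeff ?p i\<bar>" and ?T = "\<Sum>j<k. \<bar>coeff q j\<bar>"
    \<comment> \<open>As \<open>x = 1 + (x - 1)\<close>, each Taylor coefficient of \<open>p\<close>
      above order 0 is the sum of two consecutive ones of \<open>q\<close>. This recursion is solved
      for \<open>q\<close> from the bottom up.\<close>
    have pe: "?p = ?q + pCons c ?q" by (simp add: pq pcompose_pCons)
    have part: "\<bar>coeff ?q i\<bar> \<le> \<bar>c\<bar> + (\<Sum>l\<le>i. \<bar>coeff ?p l\<bar>)" for i
    proof (induction i)
      case 0
      then show ?case unfolding pe by simp
    next
      case (Suc i)
      have "coeff ?q (Suc i) = coeff ?p (Suc i) - coeff ?q i" unfolding pe by simp
      with Suc show ?case by simp
    qed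
    have "(\<Sum>i\<le>n. \<bar>coeff ?q i\<bar>) \<le> (\<Sum>i\<le>n. \<bar>c\<bar> + ?S)"
    proof (rule sum_mono)
      fix i assume "i \<in> {..n}"
      then have "(\<Sum>l\<le>i. \<bar>coeff ?p l\<bar>) \<le> ?S" by (intro sum_mono2) auto
      with part[of i] show "\<bar>coeff ?q i\<bar> \<le> \<bar>c\<bar> + ?S" by linarith
    qed
    then have sq: "(\<Sum>i\<le>n. \<bar>coeff ?q i\<bar>) \<le> (real n + 1) * (\<bar>c\<bar> + ?S)" by (simp add: add.commute)
    have "0 \<le> real n * ?T" by (simp add: sum_nonneg)
    with sq have "?T + (\<Sum>i\<le>n. \<bar>coeff ?q i\<bar>) \<le> (real n + 1) * (\<bar>c\<bar> + ?T + ?S)"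
      unfolding ring_distribs by linarith
    then have "C * (?T + (\<Sum>i\<le>n. \<bar>coeff ?q i\<bar>)) \<le> C * ((real n + 1) * (\<bar>c\<bar> + ?T + ?S))"
      using C(1) by (intro mult_left_mono) auto
    with C(2)[OF dq] have "\<bar>coeff q k\<bar> \<le> C * ((real n + 1) * (\<bar>c\<bar> + ?T + ?S))" by linarith
    moreover have "(\<Sum>j<Suc k. \<bar>coeff p j\<bar>) = \<bar>c\<bar> + ?T"
      by (simp add: pq sum.lessThan_Suc_shift del: sum.lessThan_Suc)
    ultimately show ?thesis by (simp add: pq mult.assoc del: sum.lessThan_Suc)
  qed
  moreover have "C * (real n + 1) > 0" using C(1) by simp
  ultimately show ?case by blast
qed

text \<open>Suppose all Taylor coefficients at \<open>y\<close> are below \<open>e\<close>. For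
  bounded \<open>y\<close>, expanding back about 0 makes \<open>Q\<close> too small. For large
  \<open>y\<close>, the two-point bound applied to \<open>Q(y * x)\<close> gives
  \<open>\<bar>y\<bar> ^ k\<close> at most \<open>C\<close> times the sum of
  \<open>\<bar>y\<bar> ^ j\<close> over \<open>j < k\<close> and of
  \<open>e * \<bar>y\<bar> ^ i\<close> over \<open>i \<le> m - k\<close>; since
  \<open>m - k \<le> k\<close>, this fails for small \<open>e\<close>.\<close>

lemma taylor_coeff_lower_bound:
  assumes "k \<le> m" "m \<le> 2 * k"
  shows "\<exists>e>0. \<forall>(Q::real poly) y. degree Q \<le> m \<longrightarrow> (\<forall>j. \<bar>coeff Q j\<bar> \<le> 1) \<longrightarrow> \<bar>coeff Q k\<bar> = 1 \<longrightarrow>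
     (\<exists>i\<le>m. e \<le> \<bar>coeff (Q \<circ>\<^sub>p [:y, 1:]) i\<bar>)"
proof -
  obtain C where C: "C > 0"
    "\<And>p::real poly. degree p \<le> k + (m - k) \<Longrightarrow>
     \<bar>coeff p k\<bar> \<le> C * ((\<Sum>j<k. \<bar>coeff p j\<bar>) + (\<Sum>i\<le>m - k. \<bar>coeff (p \<circ>\<^sub>p [:1, 1:]) i\<bar>))"
    using coeff_bound_two_point by blast
  \<comment> \<open>The far case ends with \<open>Y \<le> C * k + Y / 4\<close>, which is impossible
    beyond \<open>Y0\<close>.\<close>
  define Y0 where "Y0 = 1 + 2 * C * real k"
  have Y0: "Y0 \<ge> 1" using C(1) by (simp add: Y0_def)
  \<comment> \<open>The first bound serves the far case (\<open>e1\<close>), the second the near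
    case (\<open>e2\<close>).\<close>
  define e where "e = min (1 / (4 * C * (real m + 1))) (1 / (2 * (real m + 1) * (1 + Y0) ^ m))"
  have e: "e > 0" using C(1) Y0 by (simp add: e_def)
  have e1: "C * (real m + 1) * e \<le> 1 / 4"
  proof -
    have "C * (real m + 1) * e \<le> C * (real m + 1) * (1 / (4 * C * (real m + 1)))"
      using C(1) by (intro mult_left_mono) (auto simp: e_def)
    also have "\<dots> = 1 / 4" using C(1) by simp
    finally show ?thesis .
  qed
  have e2: "(1 + Y0) ^ m * ((real m + 1) * e) \<le> 1 / 2"
  proof -
    have "(1 + Y0) ^ m * (real m + 1) * e \<le> (1 + Y0) ^ m * (real m + 1) * (1 / (2 * (real m + 1) * (1 + Y0) ^ m))"
      using Y0 by (intro mult_left_mono) (auto simp: e_def)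
    also have "\<dots> = 1 / 2" using Y0 by simp
    finally show ?thesis by (simp only: mult.assoc)
  qed
  have "\<exists>i\<le>m. e \<le> \<bar>coeff (Q \<circ>\<^sub>p [:y, 1:]) i\<bar>"
    if Q: "degree Q \<le> m" "\<forall>j. \<bar>coeff Q j\<bar> \<le> 1" "\<bar>coeff Q k\<bar> = 1" for Q :: "real poly" and y
  proof (rule ccontr)
    let ?B = "Q \<circ>\<^sub>p [:y, 1:]"
    assume "\<not> ?thesis"
    then have B: "\<bar>coeff ?B i\<bar> \<le> e" if "i \<le> m" for i using that by force
    show False
    proof (cases "\<bar>y\<bar> \<le> Y0")
      case True
      have dB: "degree ?B \<le> m" using Q(1) by (simp add: degree_pcompose)
      have "Q = ?B \<circ>\<^sub>p [:-y, 1:]"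
        unfolding pcompose_assoc[symmetric] by (simp add: pcompose_pCons)
      then have "coeff_norm Q \<le> (1 + Y0) ^ m * coeff_norm ?B"
        using coeff_norm_pcompose_linear[OF dB, of "-y" 1 "1 + Y0"] True Y0 by simp
      also have "coeff_norm ?B \<le> (\<Sum>i\<le>m. e)"
        unfolding coeff_norm_altdef[OF dB] by (intro sum_mono B) auto
      finally have "coeff_norm Q \<le> (1 + Y0) ^ m * ((real m + 1) * e)"
        using Y0 by (simp add: algebra_simps)
      with abs_coeff_le_coeff_norm[of Q k] Q(3) e2 show False by linarith
    next
      case False
      define Y where "Y = \<bar>y\<bar>"
      have Y: "Y > Y0" "Y \<ge> 1" using False Y0 by (auto simp: Y_def)
      let ?R = "Q \<circ>\<^sub>p [:0, y:]"
      have R1: "?R \<circ>\<^sub>p [:1, 1:] = ?B \<circ>\<^sub>p [:0, y:]"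
        unfolding pcompose_assoc[symmetric] by (simp add: pcompose_pCons)
      have "degree ?R \<le> k + (m - k)" using Q(1) assms(1) by (simp add: degree_pcompose)
      from C(2)[OF this] have "Y ^ k \<le> C * ((\<Sum>j<k. Y ^ j * \<bar>coeff Q j\<bar>) + (\<Sum>i\<le>m - k. Y ^ i * \<bar>coeff ?B i\<bar>))"
        unfolding R1 by (simp add: coeff_pcompose_scale abs_mult power_abs Q(3) Y_def)
      \<comment> \<open>The extra factor \<open>Y\<close> turns each \<open>Y ^ j\<close> with
        \<open>j < k\<close> into a power at most \<open>Y ^ k\<close>, without an exponent
        \<open>k - 1\<close>.\<close>
      then have "Y * Y ^ k \<le> Y * (C * ((\<Sum>j<k. Y ^ j * \<bar>coeff Q j\<bar>) + (\<Sum>i\<le>m - k. Y ^ i * \<bar>coeff ?B i\<bar>)))"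
        using Y by (intro mult_left_mono) auto
      also have "\<dots> = C * ((\<Sum>j<k. Y ^ Suc j * \<bar>coeff Q j\<bar>) + Y * (\<Sum>i\<le>m - k. Y ^ i * \<bar>coeff ?B i\<bar>))"
        by (simp add: algebra_simps sum_distrib_left)
      also have "\<dots> \<le> C * ((\<Sum>j<k. Y ^ k * 1) + Y * (\<Sum>i\<le>m. Y ^ k * e))"
      proof (intro mult_left_mono add_mono)
        show "(\<Sum>j<k. Y ^ Suc j * \<bar>coeff Q j\<bar>) \<le> (\<Sum>j<k. Y ^ k * 1)"
          using Y Q(2) by (intro sum_mono mult_mono power_increasing) auto
        have "(\<Sum>i\<le>m - k. Y ^ i * \<bar>coeff ?B i\<bar>) \<le> (\<Sum>i\<le>m - k. Y ^ k * e)"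
          using Y assms by (intro sum_mono mult_mono power_increasing B) auto
        also have "\<dots> \<le> (\<Sum>i\<le>m. Y ^ k * e)"
          using Y e by (intro sum_mono2) auto
        finally show "(\<Sum>i\<le>m - k. Y ^ i * \<bar>coeff ?B i\<bar>) \<le> (\<Sum>i\<le>m. Y ^ k * e)" .
      qed (use Y C(1) in auto)
      also have "\<dots> = (C * real k + (C * (real m + 1) * e) * Y) * Y ^ k"
        by (simp add: algebra_simps)
      finally have "Y \<le> C * real k + (C * (real m + 1) * e) * Y"
        using Y by (simp add: mult_le_cancel_right)
      also have "\<dots> \<le> C * real k + 1 / 4 * Y"
        using e1 Y by (intro add_left_mono mult_right_mono) auto
      finally show False using Y C(1) by (simp add: Y0_def)
    qed
  qed
  with e show ?thesis by blast
qed

text \<open>The SND condition supplies an index \<open>k = m - j\<close> with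
  \<open>m \<le> 2 * k\<close> and coefficient of modulus 1, hence a Taylor coefficient at
  \<open>y\<close> of size at least \<open>e\<close> and some order \<open>i \<le> m\<close>. As
  \<open>r \<le> 1\<close>, a bound \<open>c * r ^ m\<close> is at most \<open>c * r ^ i\<close>,
  which is too small for it.\<close>

lemma semi_non_degenerating_large_on_interval:
  "\<exists>c>0. \<forall>(Q::real poly) r y. degree Q = m \<longrightarrow> semi_non_degenerating Q \<longrightarrow> 0 < r \<longrightarrow> r \<le> 1 \<longrightarrow>
     (\<exists>x\<in>{y..y + r}. \<bar>poly Q x\<bar> > c * r ^ m)"
proof -
  obtain C where C: "C > 0"
    "\<And>(Q::real poly) r y e i. degree Q \<le> m \<Longrightarrow> 0 < r \<Longrightarrow> (\<forall>x\<in>{y..y + r}. \<bar>poly Q x\<bar> \<le> e) \<Longrightarrow>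
     r ^ i * \<bar>coeff (Q \<circ>\<^sub>p [:y, 1:]) i\<bar> \<le> C * e"
    using taylor_coeff_bound_of_bounded[of m] by blast
  \<comment> \<open>The conditions on \<open>k\<close> sit inside the existential, with default
    value 1 when they fail, so that \<open>E\<close> is positive everywhere and so is its minimum
    over \<open>{..m}\<close>.\<close>
  have "\<forall>k. \<exists>e>0. k \<le> m \<longrightarrow> m \<le> 2 * k \<longrightarrow> (\<forall>(Q::real poly) y. degree Q \<le> m \<longrightarrow> (\<forall>j. \<bar>coeff Q j\<bar> \<le> 1) \<longrightarrow>
      \<bar>coeff Q k\<bar> = 1 \<longrightarrow> (\<exists>i\<le>m. e \<le> \<bar>coeff (Q \<circ>\<^sub>p [:y, 1:]) i\<bar>))"
    using taylor_coeff_lower_bound zero_less_one by metis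
  then obtain E :: "nat \<Rightarrow> real" where E: "\<And>k. E k > 0"
    "\<And>k (Q::real poly) y. k \<le> m \<Longrightarrow> m \<le> 2 * k \<Longrightarrow> degree Q \<le> m \<Longrightarrow> (\<forall>j. \<bar>coeff Q j\<bar> \<le> 1) \<Longrightarrow>
      \<bar>coeff Q k\<bar> = 1 \<Longrightarrow> \<exists>i\<le>m. E k \<le> \<bar>coeff (Q \<circ>\<^sub>p [:y, 1:]) i\<bar>"
    by metis
  define e where "e = Min (E ` {..m})"
  have e: "e > 0" "\<And>k. k \<le> m \<Longrightarrow> e \<le> E k" using E(1) by (auto simp: e_def)
  define c where "c = e / (2 * C)"
  have c: "c > 0" "C * c < e" using e(1) C(1) by (auto simp: c_def)
  have "\<exists>x\<in>{y..y + r}. \<bar>poly Q x\<bar> > c * r ^ m"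
    if Q: "degree Q = m" "semi_non_degenerating Q" and r: "0 < r" "r \<le> 1" for Q :: "real poly" and r y
  proof (rule ccontr)
    assume neg: "\<not> ?thesis"
    have max: "(MAX j\<in>{0..m}. \<bar>coeff Q (m - j)\<bar>) = 1"
      using Q by (simp add: semi_non_degenerating_def Let_def)
    obtain j where j: "j \<le> m" "real j \<le> real m / 2" "\<bar>coeff Q (m - j)\<bar> = 1"
      using Q by (auto simp: semi_non_degenerating_def Let_def)
    have le1: "\<bar>coeff Q i\<bar> \<le> 1" for i
    proof (cases "i \<le> m")
      case True
      then have "\<bar>coeff Q (m - (m - i))\<bar> \<le> (MAX j\<in>{0..m}. \<bar>coeff Q (m - j)\<bar>)"
        by (intro Max_ge imageI) auto
      then show ?thesis using True max by simp
    qed (use Q(1) in \<open>simp add: coeff_eq_0\<close>)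
    have "m \<le> 2 * (m - j)" using j by linarith
    then obtain i where i: "i \<le> m" "E (m - j) \<le> \<bar>coeff (Q \<circ>\<^sub>p [:y, 1:]) i\<bar>"
      using E(2)[of "m - j" Q y] Q(1) le1 j(3) by auto
    have "r ^ i * \<bar>coeff (Q \<circ>\<^sub>p [:y, 1:]) i\<bar> \<le> C * (c * r ^ m)"
      using neg Q r by (intro C(2)) (auto simp: not_less)
    also have "\<dots> \<le> C * (c * r ^ i)"
      using C(1) c(1) r i(1) by (intro mult_left_mono power_decreasing) auto
    finally have "r ^ i * \<bar>coeff (Q \<circ>\<^sub>p [:y, 1:]) i\<bar> \<le> r ^ i * (C * c)" by (simp add: mult_ac)
    then have "\<bar>coeff (Q \<circ>\<^sub>p [:y, 1:]) i\<bar> \<le> C * c" using r by simp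
    with i(2) c(2) e(2)[of "m - j"] show False by simp
  qed
  with c(1) show ?thesis by blast
qed

subsection \<open>Oscillatory integrals\<close>

text \<open>Integration by parts against the reciprocal of \<open>q * f1\<close>, the derivative of
  the phase up to \<open>\<mu>\<close>. The derivatives of \<open>1 / q\<close> and
  \<open>1 / f1\<close> are single-signed, so integrals of their absolute values reduce to end point
  values. The boundary terms contribute 2 and the variation 4 to the constant 6.\<close>

lemma oscillatory_integral_bound:
  fixes f f1 f2 :: "real \<Rightarrow> real" and P :: "real poly"
  assumes st: "s \<le> t"
    and f1: "\<And>x. x \<in> {s..t} \<Longrightarrow> (f has_real_derivative f1 x) (at x within {s..t})"
    and f2: "\<And>x. x \<in> {s..t} \<Longrightarrow> (f1 has_real_derivative f2 x) (at x within {s..t})"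
    and ss1: "single_signed_on {s..t} f1"
    and ss2: "single_signed_on {s..t} f2"
    and ssP: "single_signed_on {s..t} (\<lambda>x. poly (pderiv (pderiv P)) (f x))"
    and \<kappa>: "\<kappa> > 0" "\<And>x. x \<in> {s..t} \<Longrightarrow> \<kappa> \<le> \<bar>f1 x\<bar>"
    and \<epsilon>: "\<epsilon> > 0" "\<And>x. x \<in> {s..t} \<Longrightarrow> \<epsilon> \<le> \<bar>poly (pderiv P) (f x)\<bar>"
    and \<mu>: "\<mu> \<noteq> 0"
  shows "cmod (integral {s..t} (\<lambda>x. exp (\<i> * of_real (\<mu> * poly P (f x))))) \<le> 6 / (\<bar>\<mu>\<bar> * \<epsilon> * \<kappa>)"
proof -
  define q where "q = (\<lambda>x. poly (pderiv P) (f x))"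
  define q1 where "q1 = (\<lambda>x. poly (pderiv (pderiv P)) (f x) * f1 x)"
  define E where "E = (\<lambda>x. exp (\<i> * complex_of_real (\<mu> * poly P (f x))))"
  define G' where "G' = (\<lambda>x. - (q1 x / (q x)\<^sup>2 / f1 x) - f2 x / (f1 x)\<^sup>2 / q x)"
  have nz: "f1 x \<noteq> 0" "q x \<noteq> 0" if "x \<in> {s..t}" for x
    using \<kappa>(1) \<kappa>(2)[OF that] \<epsilon>(1) \<epsilon>(2)[OF that] by (auto simp: q_def)
  have dq: "(q has_real_derivative q1 x) (at x within {s..t})" if "x \<in> {s..t}" for x
    unfolding q_def q1_def
    by (rule DERIV_chain2[where f = "poly (pderiv P)" and g = f, OF poly_DERIV f1[OF that]])
  have dP: "((\<lambda>x. poly P (f x)) has_real_derivative q x * f1 x) (at x within {s..t})" if "x \<in> {s..t}" for x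
    unfolding q_def by (rule DERIV_chain2[where f = "poly P" and g = f, OF poly_DERIV f1[OF that]])
  have dinvq: "((\<lambda>x. 1 / q x) has_real_derivative - (q1 x / (q x)\<^sup>2)) (at x within {s..t})" if "x \<in> {s..t}" for x
    using that nz by (auto intro!: derivative_eq_intros dq simp: power2_eq_square)
  have dinvf: "((\<lambda>x. 1 / f1 x) has_real_derivative - (f2 x / (f1 x)\<^sup>2)) (at x within {s..t})" if "x \<in> {s..t}" for x
    using that nz by (auto intro!: derivative_eq_intros f2 simp: power2_eq_square)
  have dG: "((\<lambda>x. 1 / q x * (1 / f1 x)) has_real_derivative G' x) (at x within {s..t})" if "x \<in> {s..t}" for x
    by (rule DERIV_cong[OF DERIV_mult[OF dinvq[OF that] dinvf[OF that]]]) (simp add: G'_def)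
  have dE: "(E has_vector_derivative \<i> * of_real (\<mu> * (q x * f1 x)) * E x) (at x within {s..t})"
    if "x \<in> {s..t}" for x
  proof -
    have "((\<lambda>x. \<i> * complex_of_real (\<mu> * poly P (f x))) has_vector_derivative
        \<i> * of_real (\<mu> * (q x * f1 x))) (at x within {s..t})"
      using DERIV_cmult[OF dP[OF that], of \<mu>]
      by (intro has_vector_derivative_mult_right has_vector_derivative_of_real)
    from field_vector_diff_chain_within[OF this has_field_derivative_at_within[OF DERIV_exp]] show ?thesis
      unfolding E_def by (simp add: o_def mult_ac)
  qed
  define F where "F = (\<lambda>x. E x * complex_of_real (1 / q x * (1 / f1 x)))"
  have dF: "(F has_vector_derivative \<i> * \<mu> * E x + E x * of_real (G' x)) (at x within {s..t})"
    if "x \<in> {s..t}" for x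
    using has_vector_derivative_mult[OF dE[OF that]
        has_vector_derivative_of_real[OF dG[OF that]]]
      nz[OF that] unfolding F_def by (simp add: algebra_simps)
  have iF: "((\<lambda>x. \<i> * \<mu> * E x + E x * of_real (G' x)) has_integral (F t - F s)) {s..t}"
    by (rule fundamental_theorem_of_calculus[OF st dF])
  have iE: "E integrable_on {s..t}"
    by (rule integrable_continuous_interval)
      (meson continuous_on_eq_continuous_within dE has_vector_derivative_continuous)
  \<comment> \<open>\<open>f2\<close> is known only as a derivative, so integrability comes from the
    fundamental theorem after subtracting a continuous function.\<close>
  have iE': "(\<lambda>x. E x * of_real (G' x)) integrable_on {s..t}"
    using integrable_diff[OF has_integral_integrable[OF iF] integrable_on_mult_right[OF iE, of "\<i> * \<mu>"]]
    by simp
  have eq: "\<i> * \<mu> * integral {s..t} E = F t - F s - integral {s..t} (\<lambda>x. E x * of_real (G' x))"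
    using integral_unique[OF iF] integral_add[OF integrable_on_mult_right[OF iE, of "\<i> * \<mu>"] iE']
    by (simp add: algebra_simps)
  have nE: "cmod (E x) = 1" for x by (simp add: E_def)
  have bq: "\<bar>1 / q x\<bar> \<le> 1 / \<epsilon>" if "x \<in> {s..t}" for x
    using frac_le[of 1 1 \<epsilon> "\<bar>q x\<bar>"] \<epsilon>(1) \<epsilon>(2)[OF that] by (simp add: q_def)
  have bf: "\<bar>1 / f1 x\<bar> \<le> 1 / \<kappa>" if "x \<in> {s..t}" for x
    using frac_le[of 1 1 \<kappa> "\<bar>f1 x\<bar>"] \<kappa>(1) \<kappa>(2)[OF that] by simp
  have bF: "cmod (F x) \<le> 1 / (\<epsilon> * \<kappa>)" if "x \<in> {s..t}" for x
    using mult_mono[OF bq[OF that] bf[OF that]] \<epsilon> \<kappa>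
    by (simp add: F_def norm_mult nE norm_divide abs_mult)
  have "single_signed_on {s..t} q1"
    unfolding q1_def by (rule single_signed_on_mult[OF ssP ss1])
  \<comment> \<open>The sign is opposite to that of \<open>q1\<close>, since the derivative of
    \<open>1 / q\<close> carries a minus.\<close>
  then obtain \<sigma> where \<sigma>: "\<bar>\<sigma>\<bar> = 1" "\<And>x. x \<in> {s..t} \<Longrightarrow> \<sigma> * q1 x = - \<bar>q1 x\<bar>"
    by (rule single_signed_onE[of _ _ thesis]) (metis abs_minus_cancel mult_minus_left)
  obtain \<tau> where \<tau>: "\<bar>\<tau>\<bar> = 1" "\<And>x. x \<in> {s..t} \<Longrightarrow> \<tau> * f2 x = - \<bar>f2 x\<bar>"
    using ss2 by (rule single_signed_onE[of _ _ thesis]) (metis abs_minus_cancel mult_minus_left)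
  \<comment> \<open>An antiderivative of a majorant of \<open>\<bar>G'\<bar>\<close>: each
    reciprocal is weighted by the bound for the other one.\<close>
  define H where "H = (\<lambda>x. 1 / \<kappa> * (\<sigma> * (1 / q x)) + 1 / \<epsilon> * (\<tau> * (1 / f1 x)))"
  have "(H has_real_derivative 1 / \<kappa> * \<bar>q1 x / (q x)\<^sup>2\<bar> + 1 / \<epsilon> * \<bar>f2 x / (f1 x)\<^sup>2\<bar>) (at x within {s..t})"
    if "x \<in> {s..t}" for x
  proof -
    have 1: "\<sigma> * - (q1 x / (q x)\<^sup>2) = \<bar>q1 x / (q x)\<^sup>2\<bar>"
      using \<sigma>(2)[OF that] by simp
    have 2: "\<tau> * - (f2 x / (f1 x)\<^sup>2) = \<bar>f2 x / (f1 x)\<^sup>2\<bar>"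
      using \<tau>(2)[OF that] by simp
    show ?thesis
      unfolding H_def 1[symmetric] 2[symmetric]
      by (intro DERIV_add DERIV_cmult dinvq dinvf that)
  qed
  then have iH: "((\<lambda>x. 1 / \<kappa> * \<bar>q1 x / (q x)\<^sup>2\<bar> + 1 / \<epsilon> * \<bar>f2 x / (f1 x)\<^sup>2\<bar>) has_integral (H t - H s)) {s..t}"
    by (intro fundamental_theorem_of_calculus[OF st])
      (auto simp: has_real_derivative_iff_has_vector_derivative)
  have bH: "\<bar>H x\<bar> \<le> 2 / (\<epsilon> * \<kappa>)" if "x \<in> {s..t}" for x
  proof -
    have "\<bar>H x\<bar> \<le> \<bar>1 / \<kappa> * (\<sigma> * (1 / q x))\<bar> + \<bar>1 / \<epsilon> * (\<tau> * (1 / f1 x))\<bar>"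
      unfolding H_def by (rule abs_triangle_ineq)
    also have "\<dots> = 1 / \<kappa> * \<bar>1 / q x\<bar> + 1 / \<epsilon> * \<bar>1 / f1 x\<bar>"
      using \<sigma>(1) \<tau>(1) \<epsilon> \<kappa> by (simp add: abs_mult)
    also have "\<dots> \<le> 1 / \<kappa> * (1 / \<epsilon>) + 1 / \<epsilon> * (1 / \<kappa>)"
      using \<epsilon> \<kappa> by (intro add_mono mult_left_mono bq bf that) auto
    finally show ?thesis by (simp add: mult.commute)
  qed
  have "cmod (integral {s..t} (\<lambda>x. E x * of_real (G' x))) \<le> H t - H s"
    unfolding integral_unique[OF iH, symmetric]
  proof (rule integral_norm_bound_integral[OF iE' has_integral_integrable[OF iH]])
    fix x assume x: "x \<in> {s..t}"
    have "\<bar>G' x\<bar> \<le> \<bar>q1 x / (q x)\<^sup>2 / f1 x\<bar> + \<bar>f2 x / (f1 x)\<^sup>2 / q x\<bar>"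
      unfolding G'_def by linarith
    also have "\<dots> = \<bar>1 / f1 x\<bar> * \<bar>q1 x / (q x)\<^sup>2\<bar> + \<bar>1 / q x\<bar> * \<bar>f2 x / (f1 x)\<^sup>2\<bar>"
      by (simp add: abs_mult mult.commute)
    also have "\<dots> \<le> 1 / \<kappa> * \<bar>q1 x / (q x)\<^sup>2\<bar> + 1 / \<epsilon> * \<bar>f2 x / (f1 x)\<^sup>2\<bar>"
      by (intro add_mono mult_right_mono bq bf x) auto
    finally show "cmod (E x * of_real (G' x)) \<le> 1 / \<kappa> * \<bar>q1 x / (q x)\<^sup>2\<bar> + 1 / \<epsilon> * \<bar>f2 x / (f1 x)\<^sup>2\<bar>"
      by (simp add: norm_mult nE)
  qed
  moreover have "cmod (F t - F s) \<le> cmod (F t) + cmod (F s)" by (rule norm_triangle_ineq4)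
  moreover have "\<bar>\<mu>\<bar> * cmod (integral {s..t} E) = cmod (F t - F s - integral {s..t} (\<lambda>x. E x * of_real (G' x)))"
    unfolding eq[symmetric] by (simp add: norm_mult)
  moreover have "cmod (F t - F s - integral {s..t} (\<lambda>x. E x * of_real (G' x))) \<le>
      cmod (F t - F s) + cmod (integral {s..t} (\<lambda>x. E x * of_real (G' x)))"
    by (rule norm_triangle_ineq4)
  ultimately have "\<bar>\<mu>\<bar> * cmod (integral {s..t} E) \<le> 6 * (1 / (\<epsilon> * \<kappa>))"
    using bF[of s] bF[of t] bH[of s] bH[of t] st by (auto simp: abs_le_iff)
  then have "cmod (integral {s..t} E) \<le> 6 * (1 / (\<epsilon> * \<kappa>)) / \<bar>\<mu>\<bar>"
    using \<mu> by (subst pos_le_divide_eq) (simp_all add: mult.commute)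
  then show ?thesis by (simp add: E_def mult_ac)
qed

text \<open>The inequality \<^term>\<open>L \<le> C * A * (\<kappa> * L) powr \<delta>\<close> is self-improving since \<^term>\<open>\<delta> < 1\<close>;
  this is the source of the exponent \<^term>\<open>1 / (1 - \<delta>)\<close>.\<close>

lemma powr_self_improve:
  fixes L :: real
  assumes "0 < \<delta>" "\<delta> < 1" "L > 0" "C > 0" "A > 0" "r > 0"
    and L: "L \<le> C * A * (r powr (1 - \<delta>) * L) powr \<delta>"
  shows "L \<le> C powr (1 / (1 - \<delta>)) * A powr (1 / (1 - \<delta>)) * r powr \<delta>"
proof -
  have "L powr (1 - \<delta>) * L powr \<delta> = L" using assms by (simp add: powr_add[symmetric])
  also have "L \<le> (C * A * r powr ((1 - \<delta>) * \<delta>)) * L powr \<delta>"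
    using L assms by (simp add: powr_mult powr_powr mult_ac)
  finally have "L powr (1 - \<delta>) \<le> C * A * r powr ((1 - \<delta>) * \<delta>)"
    using \<open>L > 0\<close> by simp
  then have "(L powr (1 - \<delta>)) powr (1 / (1 - \<delta>)) \<le> (C * A * r powr ((1 - \<delta>) * \<delta>)) powr (1 / (1 - \<delta>))"
    using assms by (intro powr_mono2) auto
  then show ?thesis using assms by (simp add: powr_mult powr_powr)
qed

text \<open>The part common to the monic and SND cases, which differ only in how
  \<open>large\<close> is obtained. On each piece one of three estimates holds: \<open>f\<close> is
  slow, \<open>pderiv P\<close> is small along \<open>f\<close>, or both are large; the bracketed
  constant adds up the three contributions.\<close>

lemma oscillatory_integral_poly_compose:
  fixes f :: "real \<Rightarrow> real" and P :: "real poly"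
  assumes N: "N \<ge> 2" and \<delta>: "0 < \<delta>" "\<delta> < 1" and c: "c > 0"
    and ab: "a < b" and sm: "smooth_on {a..b} f"
    and ss: "single_signed_on {a..b} (higher_deriv_on {a..b} N f)" and A: "A \<ge> 1"
    and decay: "\<And>\<mu>::real. \<mu> \<noteq> 0 \<Longrightarrow>
      cmod (integral {a..b} (\<lambda>x. exp (\<i> * of_real (\<mu> * f x)))) \<le> A * \<bar>\<mu>\<bar> powr (- \<delta>)"
    and deg: "degree (pderiv P) \<le> m"
    and large: "\<And>y. \<exists>x\<in>{y..y + r}. \<bar>poly (pderiv P) x\<bar> > c * r ^ m"
    and r: "r > 0" and \<mu>: "\<bar>\<mu>\<bar> * r ^ Suc m = 1"
  shows "cmod (integral {a..b} (\<lambda>x. exp (\<i> * of_real (\<mu> * poly P (f x))))) \<le>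
    real (2 ^ (N + 1) * (2 ^ m) ^ 3) *
      (((4 / (1 - \<delta>)) powr (1 / (1 - \<delta>)) + 4 / (1 - \<delta>) + 6 / c) * A powr (1 / (1 - \<delta>)) * r powr \<delta>)"
    (is "_ \<le> _ * (?K * ?A * _)")
proof -
  define f1 where "f1 = higher_deriv_on {a..b} 1 f"
  define f2 where "f2 = higher_deriv_on {a..b} 2 f"
  \<comment> \<open>This choice balances the estimates:
    \<open>r / \<kappa> = r powr \<delta>\<close> in the integration by parts, and the self-improved
    length of a slow piece has the same order.\<close>
  define \<kappa> where "\<kappa> = r powr (1 - \<delta>)"
  define \<epsilon> where "\<epsilon> = c * r ^ m"
  have pos: "\<kappa> > 0" "\<epsilon> > 0" using r c by (auto simp: \<kappa>_def \<epsilon>_def)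
  have df: "(f has_real_derivative f1 x) (at x within {s..t})"
    if "a \<le> s" "t \<le> b" "x \<in> {s..t}" for s t x
    using smooth_on_deriv_subinterval[OF sm that, of 0] by (simp add: f1_def)
  have df1: "(f1 has_real_derivative f2 x) (at x within {s..t})"
    if "a \<le> s" "t \<le> b" "x \<in> {s..t}" for s t x
    using smooth_on_deriv_subinterval[OF sm that, of 1] by (simp add: f1_def f2_def numeral_2_eq_2)
  have cf: "continuous_on {a..b} f"
    by (rule DERIV_continuous_on[OF df]) auto
  let ?h = "\<lambda>x. exp (\<i> * complex_of_real (\<mu> * poly P (f x)))"
  have hi: "?h integrable_on {a..b}"
    by (intro integrable_continuous_interval continuous_intros cf)
  have "A powr 1 \<le> ?A"
    using A \<delta> by (intro powr_mono) (auto simp: field_simps)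
  then have AA: "A \<le> ?A" "1 \<le> ?A" using A by auto
  have sublevel: "t - s \<le> 4 / (1 - \<delta>) * A * \<rho> powr \<delta>"
    if "a \<le> s" "s \<le> t" "t \<le> b" "\<rho> > 0" "\<And>x. x \<in> {s..t} \<Longrightarrow> \<bar>f x - f s\<bar> \<le> \<rho>" for s t \<rho>
    by (rule sublevel_interval_bound[OF cf \<delta> _ decay that]) (use A in auto)
  have triv: "cmod (integral {s..t} ?h) \<le> t - s" if "a \<le> s" "s \<le> t" "t \<le> b" for s t
  proof -
    have "cmod (integral {s..t} ?h) \<le> integral {s..t} (\<lambda>x. 1::real)"
      using integrable_on_subinterval[OF hi, of s t] that by (intro integral_norm_bound_integral) auto
    then show ?thesis using that by simp
  qed
  have K: "(4 / (1 - \<delta>)) powr (1 / (1 - \<delta>)) \<ge> 0" "4 / (1 - \<delta>) \<ge> 0" "6 / c \<ge> 0"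
    using \<delta> c by auto
  have K_mono: "x * ?A * r powr \<delta> \<le> ?K * ?A * r powr \<delta>" if "x \<le> ?K" for x
    using that AA by (intro mult_right_mono) auto
  have piece: "cmod (integral {s..t} ?h) \<le> ?K * ?A * r powr \<delta>"
    if st: "a \<le> s" "s \<le> t" "t \<le> b" and all: "single_signed_all {\<lambda>x. poly (pderiv P) (f x) + \<epsilon>,
      \<lambda>x. poly (pderiv P) (f x) - \<epsilon>, \<lambda>x. poly (pderiv (pderiv P)) (f x),
      \<lambda>x. f1 x + \<kappa>, \<lambda>x. f1 x - \<kappa>, f1, f2} s t" for s t
  proof (cases "s = t")
    case True
    then show ?thesis using K AA by simp
  next
    case False
    then have L: "t - s > 0" using st by simp
    have "single_signed_on {s..t} (\<lambda>x. f1 x - \<kappa>)" "single_signed_on {s..t} (\<lambda>x. f1 x + \<kappa>)"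
      using all by (auto simp: single_signed_all_def)
    then show ?thesis
    proof (rule single_signed_on_shift_cases)
      assume small: "\<And>x. x \<in> {s..t} \<Longrightarrow> \<bar>f1 x\<bar> \<le> \<kappa>"
      have "t - s \<le> 4 / (1 - \<delta>) * A * (\<kappa> * (t - s)) powr \<delta>"
      proof (rule sublevel[OF st])
        fix x assume x: "x \<in> {s..t}"
        have "norm (f x - f s) \<le> \<kappa> * norm (x - s)"
          by (rule field_differentiable_bound[of "{s..t}" f f1]) (use df st small x in auto)
        also have "\<dots> \<le> \<kappa> * (t - s)" using x pos by (intro mult_left_mono) auto
        finally show "\<bar>f x - f s\<bar> \<le> \<kappa> * (t - s)" by simp
      qed (use L pos in auto)
      then have "t - s \<le> (4 / (1 - \<delta>)) powr (1 / (1 - \<delta>)) * ?A * r powr \<delta>"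
        unfolding \<kappa>_def using \<delta> A r L by (intro powr_self_improve) auto
      also have "\<dots> \<le> ?K * ?A * r powr \<delta>" using K by (intro K_mono) auto
      finally show ?thesis using triv[OF st] by linarith
    next
      assume big: "\<And>x. x \<in> {s..t} \<Longrightarrow> \<kappa> \<le> \<bar>f1 x\<bar>"
      have "single_signed_on {s..t} (\<lambda>x. poly (pderiv P) (f x) - \<epsilon>)"
        "single_signed_on {s..t} (\<lambda>x. poly (pderiv P) (f x) + \<epsilon>)"
        using all by (auto simp: single_signed_all_def)
      then show ?thesis
      proof (rule single_signed_on_shift_cases)
        assume small: "\<And>x. x \<in> {s..t} \<Longrightarrow> \<bar>poly (pderiv P) (f x)\<bar> \<le> \<epsilon>"
        have "t - s \<le> 4 / (1 - \<delta>) * A * r powr \<delta>"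
        proof (rule sublevel[OF st r], rule ccontr)
          fix x assume x: "x \<in> {s..t}" and far: "\<not> \<bar>f x - f s\<bar> \<le> r"
          \<comment> \<open>The image of \<open>{s..x}\<close> contains an interval of length
            \<open>r\<close> starting at the smaller of \<open>f s\<close> and \<open>f x\<close>,
            whichever way \<open>f\<close> moves; there \<open>large\<close> contradicts
            \<open>small\<close>.\<close>
          have "connected (f ` {s..x})"
            using x st by (intro connected_continuous_image continuous_on_subset[OF cf]) auto
          moreover have "min (f s) (f x) \<in> f ` {s..x}" "max (f s) (f x) \<in> f ` {s..x}"
            using x by (auto simp: min_def max_def)
          ultimately have "{min (f s) (f x)..max (f s) (f x)} \<subseteq> f ` {s..x}"
            by (intro connected_contains_Icc)
          moreover have "{min (f s) (f x)..min (f s) (f x) + r} \<subseteq> {min (f s) (f x)..max (f s) (f x)}"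
            using far by auto
          moreover obtain z where "z \<in> {min (f s) (f x)..min (f s) (f x) + r}" "\<bar>poly (pderiv P) z\<bar> > \<epsilon>"
            using large unfolding \<epsilon>_def by blast
          ultimately obtain w where "w \<in> {s..x}" "\<bar>poly (pderiv P) (f w)\<bar> > \<epsilon>" by blast
          with small[of w] x show False by auto
        qed
        also have "\<dots> \<le> 4 / (1 - \<delta>) * ?A * r powr \<delta>"
          using AA \<delta> by (intro mult_right_mono mult_left_mono) auto
        also have "\<dots> \<le> ?K * ?A * r powr \<delta>" using K by (intro K_mono) auto
        finally show ?thesis using triv[OF st] by linarith
      next
        assume big': "\<And>x. x \<in> {s..t} \<Longrightarrow> \<epsilon> \<le> \<bar>poly (pderiv P) (f x)\<bar>"
        have "\<mu> \<noteq> 0" using \<mu> by auto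
        then have "cmod (integral {s..t} ?h) \<le> 6 / (\<bar>\<mu>\<bar> * \<epsilon> * \<kappa>)"
          using all pos st
          by (intro oscillatory_integral_bound[of s t f f1 f2] df df1 big big')
            (auto simp: single_signed_all_def)
        also have "\<bar>\<mu>\<bar> * \<epsilon> * \<kappa> = c * (\<bar>\<mu>\<bar> * r ^ Suc m) * (\<kappa> / r)"
          using r by (simp add: \<epsilon>_def)
        also have "\<kappa> / r = r powr (-\<delta>)"
          using r by (simp add: \<kappa>_def powr_diff powr_minus field_simps)
        also have "6 / (c * (\<bar>\<mu>\<bar> * r ^ Suc m) * r powr (-\<delta>)) = 6 / c * 1 * r powr \<delta>"
          unfolding \<mu> by (simp add: powr_minus field_simps)
        also have "\<dots> \<le> 6 / c * ?A * r powr \<delta>"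
          using AA c by (intro mult_right_mono mult_left_mono) auto
        also have "\<dots> \<le> ?K * ?A * r powr \<delta>" using K by (intro K_mono) auto
        finally show ?thesis .
      qed
    qed
  qed
  show ?thesis
  proof (rule pieces_integral_bound[OF _ hi _ piece])
    show "pieces (single_signed_all {\<lambda>x. poly (pderiv P) (f x) + \<epsilon>,
      \<lambda>x. poly (pderiv P) (f x) - \<epsilon>, \<lambda>x. poly (pderiv (pderiv P)) (f x),
      \<lambda>x. f1 x + \<kappa>, \<lambda>x. f1 x - \<kappa>, f1, f2}) (2 ^ (N + 1) * (2 ^ m) ^ 3) a b"
      by (rule pieces_decomposition[OF N _ sm ss deg f1_def f2_def]) (use ab in simp)
    show "0 \<le> ?K * ?A * r powr \<delta>" using K AA by simp
  qed
qed

section \<open>The monic and SND cases at the scale determined by the frequency\<close>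

theorem theorem2p1:
  fixes d N :: nat and \<delta> :: real
  assumes "d \<ge> 2" and "N \<ge> 2" and "0 < \<delta>" and "\<delta> < 1"
  shows "\<exists>C::real. \<forall>(a::real) (b::real) (f :: real \<Rightarrow> real) (A::real).
           a < b \<longrightarrow>
           smooth_on {a..b} f \<longrightarrow>
           single_signed_on {a..b} (higher_deriv_on {a..b} N f) \<longrightarrow>
           A \<ge> 1 \<longrightarrow>
           (\<forall>\<mu>::real. \<mu> \<noteq> 0 \<longrightarrow>
              cmod (integral {a..b} (\<lambda>x. exp (\<i> * of_real (\<mu> * f x)))) \<le> A * \<bar>\<mu>\<bar> powr (- \<delta>)) \<longrightarrow>
           (\<forall>P :: real poly. degree P = d \<longrightarrow> lead_coeff (pderiv P) = 1 \<longrightarrow>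
              (\<forall>\<mu>::real. \<mu> \<noteq> 0 \<longrightarrow>
                 cmod (integral {a..b} (\<lambda>x. exp (\<i> * of_real (\<mu> * poly P (f x)))))
                   \<le> C * A powr (1 / (1 - \<delta>)) * \<bar>\<mu>\<bar> powr (- \<delta> / real d))) \<and>
           (\<forall>P :: real poly. degree P = d \<longrightarrow> semi_non_degenerating (pderiv P) \<longrightarrow>
              (\<forall>\<mu>::real. \<bar>\<mu>\<bar> \<ge> 1 \<longrightarrow>
                 cmod (integral {a..b} (\<lambda>x. exp (\<i> * of_real (\<mu> * poly P (f x)))))
                   \<le> C * A powr (1 / (1 - \<delta>)) * \<bar>\<mu>\<bar> powr (- \<delta> / real d)))"
proof -
  define m where "m = d - 1"
  have d: "d = Suc m" using assms by (simp add: m_def)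
  obtain c1 where c1: "c1 > 0" "\<And>(Q::real poly) r y. degree Q = m \<Longrightarrow> lead_coeff Q = 1 \<Longrightarrow> 0 < r \<Longrightarrow>
     \<exists>x\<in>{y..y + r}. \<bar>poly Q x\<bar> > c1 * r ^ m"
    using monic_large_on_interval[of m] by blast
  obtain c2 where c2: "c2 > 0" "\<And>(Q::real poly) r y. degree Q = m \<Longrightarrow> semi_non_degenerating Q \<Longrightarrow> 0 < r \<Longrightarrow>
     r \<le> 1 \<Longrightarrow> \<exists>x\<in>{y..y + r}. \<bar>poly Q x\<bar> > c2 * r ^ m"
    using semi_non_degenerating_large_on_interval[of m] by blast
  define K where "K = (\<lambda>c. real (2 ^ (N + 1) * (2 ^ m) ^ 3) *
      ((4 / (1 - \<delta>)) powr (1 / (1 - \<delta>)) + 4 / (1 - \<delta>) + 6 / c))"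
  have main: "cmod (integral {a..b} (\<lambda>x. exp (\<i> * of_real (\<mu> * poly P (f x)))))
      \<le> max (K c1) (K c2) * A powr (1 / (1 - \<delta>)) * \<bar>\<mu>\<bar> powr (- \<delta> / real d)"
    if ab: "a < b" and sm: "smooth_on {a..b} f"
      and ss: "single_signed_on {a..b} (higher_deriv_on {a..b} N f)" and A: "A \<ge> 1"
      and decay: "\<forall>\<mu>::real. \<mu> \<noteq> 0 \<longrightarrow>
        cmod (integral {a..b} (\<lambda>x. exp (\<i> * of_real (\<mu> * f x)))) \<le> A * \<bar>\<mu>\<bar> powr (- \<delta>)"
      and P: "degree P = d" and \<mu>: "\<mu> \<noteq> 0"
      and cc: "c \<in> {c1, c2}"
      and large: "\<And>y. \<exists>x\<in>{y..y + \<bar>\<mu>\<bar> powr (-1 / real d)}.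
        \<bar>poly (pderiv P) x\<bar> > c * (\<bar>\<mu>\<bar> powr (-1 / real d)) ^ m"
    for a b A \<mu> c :: real and f and P :: "real poly"
  proof -
    \<comment> \<open>The scale at which \<open>\<bar>\<mu>\<bar> * r ^ d = 1\<close>; it converts
      \<open>r powr \<delta>\<close> into the decay exponent \<open>-\<delta> / d\<close>.\<close>
    define r where "r = \<bar>\<mu>\<bar> powr (-1 / real d)"
    have r: "r > 0" using \<mu> by (simp add: r_def)
    have "r ^ Suc m = r powr real d" using r by (simp only: d powr_realpow)
    also have "\<dots> = \<bar>\<mu>\<bar> powr (-1)" by (simp add: r_def powr_powr d)
    finally have r\<mu>: "\<bar>\<mu>\<bar> * r ^ Suc m = 1" using \<mu> by (simp add: powr_minus)
    have rd: "r powr \<delta> = \<bar>\<mu>\<bar> powr (- \<delta> / real d)" by (simp add: r_def powr_powr)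
    have "cmod (integral {a..b} (\<lambda>x. exp (\<i> * of_real (\<mu> * poly P (f x))))) \<le>
        K c * A powr (1 / (1 - \<delta>)) * r powr \<delta>"
      unfolding K_def mult.assoc[of "real _"]
      by (rule oscillatory_integral_poly_compose[OF assms(2-4) _ ab sm ss A])
        (use c1 c2 cc decay P large r r\<mu> in \<open>auto simp: r_def d degree_pderiv\<close>)
    also have "\<dots> \<le> max (K c1) (K c2) * A powr (1 / (1 - \<delta>)) * r powr \<delta>"
      using cc by (intro mult_right_mono) auto
    finally show ?thesis by (simp only: rd)
  qed
  show ?thesis
  proof (intro exI[of _ "max (K c1) (K c2)"] allI impI conjI)
    fix a b A \<mu> :: real and f and P :: "real poly"
    assume *: "a < b" "smooth_on {a..b} f" "single_signed_on {a..b} (higher_deriv_on {a..b} N f)" "A \<ge> 1"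
      "\<forall>\<mu>::real. \<mu> \<noteq> 0 \<longrightarrow>
        cmod (integral {a..b} (\<lambda>x. exp (\<i> * of_real (\<mu> * f x)))) \<le> A * \<bar>\<mu>\<bar> powr (- \<delta>)"
      "degree P = d"
    {
      assume "lead_coeff (pderiv P) = 1" and "\<mu> \<noteq> 0"
      then show "cmod (integral {a..b} (\<lambda>x. exp (\<i> * of_real (\<mu> * poly P (f x)))))
          \<le> max (K c1) (K c2) * A powr (1 / (1 - \<delta>)) * \<bar>\<mu>\<bar> powr (- \<delta> / real d)"
        using * by (intro main[where c = c1] c1(2)) (auto simp: degree_pderiv d)
    next
      assume snd: "semi_non_degenerating (pderiv P)" and \<mu>: "\<bar>\<mu>\<bar> \<ge> 1"
      then have "\<mu> \<noteq> 0" by auto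
      \<comment> \<open>The restriction on \<open>\<mu>\<close> enters here: it gives a scale of at
        most 1, as the SND lower bound requires.\<close>
      have "\<bar>\<mu>\<bar> powr (-1 / real d) \<le> \<bar>\<mu>\<bar> powr 0"
        using \<mu> by (intro powr_mono) auto
      then have "\<bar>\<mu>\<bar> powr (-1 / real d) \<le> 1" using \<open>\<mu> \<noteq> 0\<close> by simp
      with snd \<open>\<mu> \<noteq> 0\<close> show "cmod (integral {a..b} (\<lambda>x. exp (\<i> * of_real (\<mu> * poly P (f x)))))
          \<le> max (K c1) (K c2) * A powr (1 / (1 - \<delta>)) * \<bar>\<mu>\<bar> powr (- \<delta> / real d)"
        using * by (intro main[where c = c2] c2(2)) (auto simp: degree_pderiv d)
    }
  qed
qed

end
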